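(* Let $0<\lambda<1$ and let $d\ge2$ be a fixed integer. For each $n$ let $\hat Y$ have the (unique) stationary distribution $\hat\pi$ of the supermarket jump chain with $n$ queues. (a) There is a constant $c>0$ such that for all sufficiently large $n$, for every function $f:S\to\mathbb R$ that is 1-Lipschitz with respect to the $\ell_1$ distance and every $u\ge1$, $$\mathbb P_{\hat\pi}\big(|f(\hat Y)-\mathbb E_{\hat\pi}[f(\hat Y)]|\ge 2u\big)\le 2e^{-u^2/(4c(n+u))}+2e^{-(\log n)^2/c}.$$ (b) For every constant $c_0>0$ there is a constant $c>0$ such that for all sufficiently large $n$, for every function $f:S\to\mathbb R$ that is 1-Lipschitz with respect to the $\ell_1$ distance and every $u$ with $0<u\le c_0n^{1/2}\log n$, $$\mathbb P_{\hat\pi}\big(|f(\hat Y)-\mathbb E_{\hat\pi}[f(\hat Y)]|\ge 2u\big)\le c\,e^{-u^2/(cn)}.$$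
   Context: The supermarket jump chain with $n$ queues, arrival parameter $\lambda$ and $d$ choices is the discrete-time Markov chain $(\hat X_t)$ on $S=\{0,1,2,\dots\}^n$ (vectors of queue lengths) with the following transitions. At each step, independently of the past, the event is an arrival with probability $\lambda/(1+\lambda)$ and a potential departure with probability $1/(1+\lambda)$. If it is an arrival, a uniformly random $d$-tuple of queues is chosen (with replacement), and the length of the first shortest queue in this list is increased by 1. If it is a potential departure, one of the $n$ queues is chosen uniformly at random, and its length is decreased by 1 if it is non-empty; otherwise nothing happens. This chain has a unique stationary distribution $\hat\pi$. $f$ is 1-Lipschitz if $|f(x)-f(y)|\le\|x-y\|_1$ for all $x,y\in S$. *)

theory Defs
  imports "HOL-Probability.Probability"
begin

text \<open>A state is the list of the n queue lengths; queues are indexed by 0, ..., n - 1.\<close>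

definition queue_states :: "nat \<Rightarrow> nat list set" where
  "queue_states n = {x. length x = n}"

text \<open>The choices are a uniform d-tuple of queues, with replacement. Ties in
  \<^const>\<open>arg_min_list\<close> go to the earliest list element, so it returns the first shortest queue.\<close>

definition arrival :: "nat \<Rightarrow> nat \<Rightarrow> nat list \<Rightarrow> nat list pmf" where
  "arrival n d x =
     map_pmf (\<lambda>js. let j = arg_min_list (\<lambda>i. x ! i) js in x[j := x ! j + 1])
       (pmf_of_set {js. set js \<subseteq> {..<n} \<and> length js = d})"

text \<open>Truncated subtraction on \<^typ>\<open>nat\<close> leaves an empty queue unchanged.\<close>

definition departure :: "nat \<Rightarrow> nat list \<Rightarrow> nat list pmf" where
  "departure n x = map_pmf (\<lambda>i. x[i := x ! i - 1]) (pmf_of_set {..<n})"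

definition jump_kernel :: "real \<Rightarrow> nat \<Rightarrow> nat \<Rightarrow> nat list \<Rightarrow> nat list pmf" where
  "jump_kernel lam d n x =
     bind_pmf (bernoulli_pmf (lam / (1 + lam)))
       (\<lambda>is_arrival. if is_arrival then arrival n d x else departure n x)"

definition stationary_distribution :: "real \<Rightarrow> nat \<Rightarrow> nat \<Rightarrow> nat list pmf \<Rightarrow> bool" where
  "stationary_distribution lam d n p \<longleftrightarrow>
     set_pmf p \<subseteq> queue_states n \<and> bind_pmf p (jump_kernel lam d n) = p"

definition l1_dist :: "nat \<Rightarrow> nat list \<Rightarrow> nat list \<Rightarrow> real" where
  "l1_dist n x y = (\<Sum>i<n. \<bar>real (x ! i) - real (y ! i)\<bar>)"

definition lipschitz1 :: "nat \<Rightarrow> (nat list \<Rightarrow> real) \<Rightarrow> bool" where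
  "lipschitz1 n f \<longleftrightarrow>
     (\<forall>x\<in>queue_states n. \<forall>y\<in>queue_states n. \<bar>f x - f y\<bar> \<le> l1_dist n x y)"

end

(* The chain is driven by random events, and applying the same event to two states couples them. Two
   copies that differ by one customer keep differing by at most one customer. If the number of queues
   of length at least a constant h0 is small, the extra customer is rarely chosen by an arrival when it
   sits in a queue that long, and a weight of exponential growth in its queue length contracts by a
   factor 1 - rate/n per step. So P^i f changes by at most shrink^i W(h) + visits_i when a customer is
   added to a queue of length h, where visits_i is the expected number of visits to states with too
   many long queues; these have exponentially small stationary probability.

   Let E(t, x) be the product over the queues of 1 + t rho^(x_j), with log E(t, x) = Psi t x. One step
   turns E(t, .) into at most E(t (1 - c/n), .) times a factor with logarithm t - const * mean_sat.
   Iterating under the stationary distribution gives E[rho^(number of customers)] <= exp(O(n)).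
   For the theorem, iterate exp(theta P^i f + A theta^2 Psi(shrink^i, .)): the negative term in the drift
   of Psi compensates the conditional variance of P^i f, since a discrepancy in a long queue, although
   it survives for a long time, is chosen with probability only O(1/n). Only the sources shrink^i remain,
   and their sum is O(n). Each function is cut off at exp(2 theta u), so that exceptional states cost an
   additive error that does not depend on u. *)

theory Submission
  imports Defs "HOL-Real_Asymp.Real_Asymp"
begin

section \<open>Tuples of queues, events and stationarity\<close>

text \<open>The obstacle is the time scale. One queue may hold order n customers and the contraction
  per step is only 1 - rate / n, so the start is forgotten after order n^2 steps; allowing a change
  of order 1 in each of them would give a variance of order n^2 instead of n. The variance therefore
  has to be read off the state. Up to \<open>visits\<close>, a customer in queue j influences P^i f
  by at most min 1 (shrink^i * W (x ! j)), and this is comparable to z / (1 + z) with z = shrink^i *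
  rho^(x ! j), the derivative of ln (1 + t * rho^(x ! j)) in ln t at t = shrink^i. This explains the
  product of the factors 1 + t * rho^(x ! j): its drift, the cost of lowering t, and the conditional
  variance of P^i f are all controlled by the same average \<open>mean_sat\<close>.\<close>

lemma card_lists_nth_in:
  assumes "\<And>i. i < d \<Longrightarrow> finite (C i)"
  shows "card {js. length js = d \<and> (\<forall>i<d. js ! i \<in> C i)} = (\<Prod>i<d. card (C i))"
  using assms
proof (induction d arbitrary: C)
  case 0
  then show ?case by simp
next
  case (Suc d)
  have eq: "{js. length js = Suc d \<and> (\<forall>i<Suc d. js ! i \<in> C i)} =
      (\<lambda>(a, l). a # l) ` (C 0 \<times> {js. length js = d \<and> (\<forall>i<d. js ! i \<in> C (Suc i))})"
    by (auto simp: length_Suc_conv image_iff All_less_Suc2)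
  have "card {js. length js = Suc d \<and> (\<forall>i<Suc d. js ! i \<in> C i)} =
      card (C 0 \<times> {js. length js = d \<and> (\<forall>i<d. js ! i \<in> C (Suc i))})"
    unfolding eq by (rule card_image) (auto simp: inj_on_def)
  also have "\<dots> = card (C 0) * (\<Prod>i<d. card (C (Suc i)))"
    using Suc.IH[of "\<lambda>i. C (Suc i)"] Suc.prems by (simp add: card_cartesian_product)
  also have "\<dots> = (\<Prod>i<Suc d. card (C i))"
    by (simp only: prod.lessThan_Suc_shift)
  finally show ?case .
qed

section \<open>Counting d-tuples of queues by their entries\<close>

definition tuples :: "nat \<Rightarrow> nat \<Rightarrow> nat list set" where
  "tuples n d = {js. set js \<subseteq> {..<n} \<and> length js = d}"

lemma tuples_alt: "tuples n d = {js. length js = d \<and> (\<forall>i<d. js ! i \<in> {..<n})}"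
  unfolding tuples_def by (auto simp: set_conv_nth subset_iff)

lemma finite_tuples: "finite (tuples n d)"
  unfolding tuples_def by (rule finite_lists_length_eq) simp

lemma card_tuples: "card (tuples n d) = n ^ d"
  unfolding tuples_def by (simp add: card_lists_length_eq)

lemma card_tuples_nth_eq:
  assumes "r < d" "j < n"
  shows "card {js \<in> tuples n d. js ! r = j} = n ^ (d - 1)"
proof -
  have "{js \<in> tuples n d. js ! r = j}
      = {js. length js = d \<and> (\<forall>i<d. js ! i \<in> (if i = r then {j} else {..<n}))}"
    using assms by (auto simp: tuples_alt split: if_splits)
  also have "card \<dots> = (\<Prod>i<d. card (if i = r then {j} else {..<n}))"
    by (rule card_lists_nth_in) auto
  also have "\<dots> = (\<Prod>i\<in>insert r ({..<d} - {r}). if i = r then 1 else n)"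
    using assms by (intro prod.cong) auto
  also have "\<dots> = (\<Prod>i\<in>{..<d} - {r}. if i = r then 1 else n)"
    by (subst prod.insert) auto
  also have "\<dots> = (\<Prod>i\<in>{..<d} - {r}. n)"
    by (intro prod.cong) auto
  also have "\<dots> = n ^ (d - 1)"
    using assms by simp
  finally show ?thesis .
qed

lemma card_tuples_nth_eq_nth_in:
  assumes "r < d" "r' < d" "r \<noteq> r'" "j < n" "A \<subseteq> {..<n}"
  shows "card {js \<in> tuples n d. js ! r = j \<and> js ! r' \<in> A} = card A * n ^ (d - 2)"
proof -
  have fin: "finite A" using assms finite_subset by blast
  have "{js \<in> tuples n d. js ! r = j \<and> js ! r' \<in> A}
      = {js. length js = d \<and> (\<forall>i<d. js ! i \<in> (if i = r then {j} else if i = r' then A else {..<n}))}"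
    using assms by (auto simp: tuples_alt split: if_splits)
  also have "card \<dots> = (\<Prod>i<d. card (if i = r then {j} else if i = r' then A else {..<n}))"
    using fin by (intro card_lists_nth_in) auto
  also have "\<dots> = (\<Prod>i\<in>insert r (insert r' ({..<d} - {r, r'})).
      if i = r then 1 else if i = r' then card A else n)"
    using assms by (intro prod.cong) auto
  also have "\<dots> = card A * (\<Prod>i\<in>{..<d} - {r, r'}. if i = r then 1 else if i = r' then card A else n)"
    using assms by (simp add: prod.insert)
  also have "(\<Prod>i\<in>{..<d} - {r, r'}. if i = r then 1 else if i = r' then card A else n) =
      (\<Prod>i\<in>{..<d} - {r, r'}. n)"
    by (intro prod.cong) auto
  also have "\<dots> = n ^ (d - 2)"
    using assms by (simp add: card_Diff_subset numeral_2_eq_2)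
  finally show ?thesis .
qed

lemma sum_tuples_hd:
  fixes h :: "nat \<Rightarrow> real"
  assumes "0 < d"
  shows "(\<Sum>js\<in>tuples n d. h (js ! 0)) = real n ^ (d - 1) * (\<Sum>k<n. h k)"
proof -
  have "(\<Sum>js\<in>tuples n d. h (js ! 0)) =
      (\<Sum>k\<in>{..<n}. \<Sum>js\<in>{js \<in> tuples n d. js ! 0 = k}. h (js ! 0))"
    using assms by (intro sum.group[symmetric] finite_tuples) (auto simp: tuples_alt)
  also have "\<dots> = (\<Sum>k\<in>{..<n}. real n ^ (d - 1) * h k)"
    using assms by (intro sum.cong) (simp_all add: card_tuples_nth_eq)
  finally show ?thesis by (simp add: sum_distrib_left)
qed

section \<open>Single events and averages over them\<close>

definition incr :: "nat list \<Rightarrow> nat \<Rightarrow> nat list" where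
  "incr x j = x[j := x ! j + 1]"

definition decr :: "nat list \<Rightarrow> nat \<Rightarrow> nat list" where
  "decr x j = x[j := x ! j - 1]"

abbreviation shortest :: "nat list \<Rightarrow> nat list \<Rightarrow> nat" where
  "shortest x js \<equiv> arg_min_list (\<lambda>i. x ! i) js"

lemma length_incr [simp]: "length (incr x j) = length x"
  and length_decr [simp]: "length (decr x j) = length x"
  by (simp_all add: incr_def decr_def)

lemma nth_incr: "j < length x \<Longrightarrow> incr x j ! i = (if i = j then x ! j + 1 else x ! i)"
  and nth_decr: "j < length x \<Longrightarrow> decr x j ! i = (if i = j then x ! j - 1 else x ! i)"
  by (auto simp: incr_def decr_def)

lemma incr_decr: "j < length x \<Longrightarrow> x ! j > 0 \<Longrightarrow> incr (decr x j) j = x"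
  by (auto simp: incr_def decr_def)

lemma decr_eq_self: "x ! j = 0 \<Longrightarrow> decr x j = x"
  by (metis decr_def diff_0_eq_0 list_update_id)

text \<open>A single random event drives the chain from every state, which couples the chains started at
  all states.\<close>

primrec step :: "nat list \<Rightarrow> nat list + nat \<Rightarrow> nat list" where
  "step x (Inl js) = incr x (shortest x js)"
| "step x (Inr i) = decr x i"

lemma length_step [simp]: "length (step x \<omega>) = length x"
  by (cases \<omega>) auto

locale supermarket =
  fixes lam :: real and d n :: nat
  assumes lam_pos: "0 < lam" and lam_less: "lam < 1" and d_ge: "2 \<le> d" and n_pos: "1 \<le> n"
begin

definition events :: "(nat list + nat) set" where
  "events = tuples n d <+> {..<n}"

definition weight :: "nat list + nat \<Rightarrow> real" where
  "weight \<omega> = (case \<omega> of Inl _ \<Rightarrow> lam / (1 + lam) / real n ^ d | Inr _ \<Rightarrow> 1 / (1 + lam) / real n)"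

definition avg :: "(nat list + nat \<Rightarrow> real) \<Rightarrow> real" where
  "avg h = (\<Sum>\<omega>\<in>events. weight \<omega> * h \<omega>)"

definition trans :: "(nat list \<Rightarrow> real) \<Rightarrow> nat list \<Rightarrow> real" where
  "trans g x = avg (\<lambda>\<omega>. g (step x \<omega>))"

lemma finite_events [simp]: "finite events"
  unfolding events_def by (simp add: finite_tuples)

lemma weight_nonneg: "0 \<le> weight \<omega>"
  using lam_pos by (auto simp: weight_def split: sum.splits)

lemma avg_split:
  "avg h = lam / (1 + lam) * ((\<Sum>js\<in>tuples n d. h (Inl js)) / real n ^ d)
     + 1 / (1 + lam) * ((\<Sum>i<n. h (Inr i)) / real n)"
  unfolding avg_def events_def
  by (subst sum.Plus) (simp_all add: finite_tuples weight_def sum_divide_distrib sum_distrib_left)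

lemma avg_mono: "(\<And>\<omega>. \<omega> \<in> events \<Longrightarrow> h \<omega> \<le> h' \<omega>) \<Longrightarrow> avg h \<le> avg h'"
  unfolding avg_def by (intro sum_mono mult_left_mono weight_nonneg)

lemma avg_add: "avg (\<lambda>\<omega>. h \<omega> + h' \<omega>) = avg h + avg h'"
  unfolding avg_def by (simp add: algebra_simps sum.distrib)

lemma avg_diff: "avg (\<lambda>\<omega>. h \<omega> - h' \<omega>) = avg h - avg h'"
  unfolding avg_def by (simp add: algebra_simps sum_subtractf)

lemma avg_cmult: "avg (\<lambda>\<omega>. c * h \<omega>) = c * avg h"
  unfolding avg_def sum_distrib_left by (intro sum.cong) auto

lemma avg_const [simp]: "avg (\<lambda>\<omega>. c) = c"
proof -
  have "avg (\<lambda>\<omega>. c) = lam / (1 + lam) * c + 1 / (1 + lam) * c"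
    unfolding avg_split using n_pos by (simp add: card_tuples)
  also have "\<dots> = (lam + 1) / (1 + lam) * c"
    by (simp only: add_divide_distrib distrib_right)
  also have "(lam + 1) / (1 + lam) = 1"
    using lam_pos by simp
  finally show ?thesis by simp
qed

lemma avg_nonneg: "(\<And>\<omega>. \<omega> \<in> events \<Longrightarrow> 0 \<le> h \<omega>) \<Longrightarrow> 0 \<le> avg h"
  unfolding avg_def by (intro sum_nonneg mult_nonneg_nonneg weight_nonneg)

lemma abs_avg_le: "\<bar>avg h\<bar> \<le> avg (\<lambda>\<omega>. \<bar>h \<omega>\<bar>)"
  unfolding avg_def using sum_abs[of "\<lambda>\<omega>. weight \<omega> * h \<omega>" events] weight_nonneg
  by (simp add: abs_mult)

lemma trans_diff: "trans (\<lambda>x. g x - g' x) x = trans g x - trans g' x"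
  and trans_const [simp]: "trans (\<lambda>x. c) x = c"
  by (simp_all add: trans_def avg_add avg_diff)

lemma trans_nonneg: "(\<And>y. 0 \<le> g y) \<Longrightarrow> 0 \<le> trans g x"
  unfolding trans_def by (rule avg_nonneg)

lemma event_cases:
  assumes "\<omega> \<in> events"
  obtains (arr) js where "\<omega> = Inl js" "js \<noteq> []" "set js \<subseteq> {..<n}" "length js = d"
  | (dep) i where "\<omega> = Inr i" "i < n"
proof (cases \<omega>)
  case (Inl js)
  then show ?thesis
    using assms d_ge arr[of js] by (cases js) (auto simp: events_def tuples_def)
next
  case (Inr i)
  then show ?thesis
    using assms dep[of i] by (auto simp: events_def)
qed

lemma shortest_less:
  "js \<in> tuples n d \<Longrightarrow> shortest x js < n"
  using arg_min_list_in[of js "\<lambda>i. x ! i"] d_ge by (cases js) (auto simp: tuples_def)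

lemma finite_set_jump_kernel: "finite (set_pmf (jump_kernel lam d n x))"
proof -
  have t: "{js. set js \<subseteq> {..<n} \<and> length js = d} \<noteq> {}"
    using card_tuples[of n d] n_pos unfolding tuples_def by (metis card.empty power_eq_0_iff not_one_le_zero)
  have f: "finite {js. set js \<subseteq> {..<n} \<and> length js = d}"
    using finite_tuples unfolding tuples_def by blast
  have "{..<n} \<noteq> {}" using n_pos by (metis lessThan_iff empty_iff less_eq_Suc_le One_nat_def)
  with t f show ?thesis
    unfolding jump_kernel_def arrival_def departure_def
    by (auto simp: set_bind_pmf)
qed

text \<open>Links the kernel to \<open>trans\<close>: from here on one step of the chain is a finite
  weighted sum over events.\<close>

lemma expectation_jump_kernel:
  "measure_pmf.expectation (jump_kernel lam d n x) g = trans g x"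
proof -
  have t: "tuples n d \<noteq> {}"
    using card_tuples[of n d] n_pos by (metis card.empty power_eq_0_iff not_one_le_zero)
  have n: "{..<n} \<noteq> {}" using n_pos by (metis lessThan_iff empty_iff less_eq_Suc_le One_nat_def)
  have p: "0 \<le> lam / (1 + lam)" "lam / (1 + lam) \<le> 1"
    using lam_pos by auto
  have fin: "finite (set_pmf (if b then arrival n d x else departure n x))" for b
    unfolding arrival_def departure_def using t n finite_tuples[of n d] by (auto simp: tuples_def)
  have a: "measure_pmf.expectation (arrival n d x) g =
      (\<Sum>js\<in>tuples n d. g (step x (Inl js))) / real n ^ d"
    unfolding arrival_def tuples_def[symmetric]
    using t finite_tuples by (simp add: integral_pmf_of_set card_tuples incr_def Let_def)
  have b: "measure_pmf.expectation (departure n x) g = (\<Sum>i<n. g (step x (Inr i))) / real n"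
    unfolding departure_def using n by (simp add: integral_pmf_of_set decr_def)
  have "measure_pmf.expectation (jump_kernel lam d n x) g =
      (\<Sum>b\<in>UNIV. pmf (bernoulli_pmf (lam / (1 + lam))) b *
        measure_pmf.expectation (if b then arrival n d x else departure n x) g)"
    unfolding jump_kernel_def by (subst pmf_expectation_bind[of UNIV]) (use fin in auto)
  also have "\<dots> = lam / (1 + lam) * measure_pmf.expectation (arrival n d x) g +
      (1 - lam / (1 + lam)) * measure_pmf.expectation (departure n x) g"
    using p by (simp add: UNIV_bool)
  also have "1 - lam / (1 + lam) = 1 / (1 + lam)"
    using lam_pos by (simp add: field_simps)
  finally show ?thesis
    unfolding trans_def avg_split a b by simp
qed

end

section \<open>Integration against a stationary distribution\<close>

locale stationary_supermarket = supermarket +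
  fixes p :: "nat list pmf"
  assumes stationary: "stationary_distribution lam d n p"
begin

lemma length_of_set_pmf: "x \<in> set_pmf p \<Longrightarrow> length x = n"
  using stationary unfolding stationary_distribution_def queue_states_def by auto

text \<open>For nonnegative integrals stationarity needs no integrability; integrability of
  \<open>trans g\<close> is then read off from the common finite value.\<close>

lemma nn_integral_trans:
  assumes "\<And>x. 0 \<le> g x"
  shows "(\<integral>\<^sup>+x. ennreal (g x) \<partial>p) = (\<integral>\<^sup>+x. ennreal (trans g x) \<partial>p)"
proof -
  have "(\<integral>\<^sup>+x. ennreal (g x) \<partial>p) = (\<integral>\<^sup>+x. ennreal (g x) \<partial>(bind_pmf p (jump_kernel lam d n)))"
    using stationary unfolding stationary_distribution_def by simp
  also have "\<dots> = (\<integral>\<^sup>+x. \<integral>\<^sup>+y. ennreal (g y) \<partial>jump_kernel lam d n x \<partial>p)"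
    by simp
  also have "\<dots> = (\<integral>\<^sup>+x. ennreal (trans g x) \<partial>p)"
  proof (rule nn_integral_cong)
    fix x
    show "(\<integral>\<^sup>+y. ennreal (g y) \<partial>jump_kernel lam d n x) = ennreal (trans g x)"
      using assms
      by (subst nn_integral_eq_integral)
        (auto simp: expectation_jump_kernel intro: integrable_measure_pmf_finite finite_set_jump_kernel)
  qed
  finally show ?thesis .
qed

lemma
  assumes "\<And>x. 0 \<le> g x" "integrable p g"
  shows integrable_trans_nonneg: "integrable p (trans g)"
    and expectation_trans_nonneg: "measure_pmf.expectation p (trans g) = measure_pmf.expectation p g"
proof -
  have *: "\<And>x. 0 \<le> trans g x" using assms(1) by (rule trans_nonneg)
  have "(\<integral>\<^sup>+x. ennreal (g x) \<partial>p) = ennreal (measure_pmf.expectation p g)"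
    using assms by (intro nn_integral_eq_integral) auto
  then have eq: "(\<integral>\<^sup>+x. ennreal (trans g x) \<partial>p) = ennreal (measure_pmf.expectation p g)"
    using nn_integral_trans assms(1) by simp
  then show 1: "integrable p (trans g)"
    using * by (intro integrableI_nonneg) auto
  have "ennreal (measure_pmf.expectation p (trans g)) = ennreal (measure_pmf.expectation p g)"
    using eq * 1 by (subst nn_integral_eq_integral[symmetric]) auto
  then show "measure_pmf.expectation p (trans g) = measure_pmf.expectation p g"
    using assms(1) * by (subst (asm) ennreal_inj) (auto intro: integral_nonneg_AE)
qed

lemma
  assumes "integrable p g"
  shows integrable_trans: "integrable p (trans g)"
    and expectation_trans: "measure_pmf.expectation p (trans g) = measure_pmf.expectation p g"
proof -
  define a b where "a = (\<lambda>x. max (g x) 0)" and "b = (\<lambda>x. max (- g x) 0)"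
  have ab: "g = (\<lambda>x. a x - b x)" by (auto simp: a_def b_def)
  have int: "integrable p a" "integrable p b"
    using assms by (auto simp: a_def b_def)
  have nn: "\<And>x. 0 \<le> a x" "\<And>x. 0 \<le> b x" by (auto simp: a_def b_def)
  have t: "trans g = (\<lambda>x. trans a x - trans b x)"
    by (subst ab) (simp add: trans_diff fun_eq_iff)
  show "integrable p (trans g)"
    unfolding t using nn int by (intro Bochner_Integration.integrable_diff integrable_trans_nonneg)
  show "measure_pmf.expectation p (trans g) = measure_pmf.expectation p g"
    unfolding t using int nn
    by (subst Bochner_Integration.integral_diff)
      (auto simp: integrable_trans_nonneg expectation_trans_nonneg ab[symmetric]
        Bochner_Integration.integral_diff[symmetric])
qed

end

section \<open>Exponential moments of the number of customers\<close>

definition total :: "nat list \<Rightarrow> nat" where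
  "total x = (\<Sum>j<length x. x ! j)"

section \<open>The potential \<open>Psi\<close> and its drift\<close>

context supermarket
begin

text \<open>Here 1 / rho is the midpoint of lam and 1. For a single queue the drift of rho^h is
  proportional to (rho - 1) * (lam - 1 / rho), negative exactly when 1 < rho < 1 / lam;
  \<open>eta_eq\<close> evaluates it for this choice.\<close>

definition rho :: real where "rho = 2 / (1 + lam)"

definition eta :: real where "eta = (rho - 1)\<^sup>2 / 2"

text \<open>The derivative of ln (1 + t * rho ^ h) with respect to ln t; up to a factor 2 it is min
  1 (t * rho ^ h).\<close>

definition sat :: "real \<Rightarrow> nat \<Rightarrow> real" where
  "sat t h = t * rho ^ h / (1 + t * rho ^ h)"

definition Psi :: "real \<Rightarrow> nat list \<Rightarrow> real" where
  "Psi t x = (\<Sum>j<n. ln (1 + t * rho ^ (x ! j)))"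

lemma rho_gt_1: "1 < rho" and rho_less_2: "rho < 2"
  and lam_rho_less_1: "lam * rho < 1"
  using lam_pos lam_less by (auto simp: rho_def field_simps)

lemma eta_pos: "0 < eta" and eta_le_half: "eta \<le> 1 / 2"
proof -
  show "0 < eta" using rho_gt_1 by (simp add: eta_def)
  have "(rho - 1)\<^sup>2 \<le> 1\<^sup>2" using rho_gt_1 rho_less_2 by (intro power_mono) auto
  then show "eta \<le> 1 / 2" by (simp add: eta_def)
qed

lemma eta_eq: "(lam * (rho - 1) - (1 - 1 / rho)) / (1 + lam) = - eta"
proof -
  have "1 + lam \<noteq> 0" using lam_pos by auto
  then show ?thesis
    unfolding eta_def rho_def by (simp add: divide_simps) (simp add: algebra_simps power2_eq_square)
qed

lemma sat_nonneg: "0 \<le> t \<Longrightarrow> 0 \<le> sat t h"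
  using rho_gt_1 by (simp add: sat_def)

lemma sat_mono:
  assumes "0 \<le> t" "h \<le> k"
  shows "sat t h \<le> sat t k"
proof -
  have 1: "t * rho ^ h \<le> t * rho ^ k"
    using assms rho_gt_1 by (intro mult_left_mono power_increasing) auto
  have 0: "0 \<le> t * rho ^ h" using assms rho_gt_1 by simp
  show ?thesis unfolding sat_def using 0 1 by (simp add: field_simps)
qed

lemma sat_0_le: "0 \<le> t \<Longrightarrow> sat t 0 \<le> t"
  by (simp add: sat_def field_simps)

lemma Psi_nonneg: "0 \<le> t \<Longrightarrow> 0 \<le> Psi t x"
  unfolding Psi_def using rho_gt_1 by (intro sum_nonneg ln_ge_zero) auto

lemma Psi_update:
  assumes "length x = n" "j < n"
  shows "Psi t (x[j := h]) - Psi t x = ln (1 + t * rho ^ h) - ln (1 + t * rho ^ (x ! j))"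
proof -
  have "Psi t (x[j := h]) - Psi t x =
      (\<Sum>i<n. if i = j then ln (1 + t * rho ^ h) - ln (1 + t * rho ^ (x ! j)) else 0)"
    unfolding Psi_def sum_subtractf[symmetric] using assms by (intro sum.cong) auto
  also have "\<dots> = ln (1 + t * rho ^ h) - ln (1 + t * rho ^ (x ! j))"
    using assms by simp
  finally show ?thesis .
qed

text \<open>One factor 1 + z becomes 1 + rho * z, and the quotient is affine in \<open>sat\<close>.
  A removal behaves alike, so gains and losses are measured in one quantity.\<close>

lemma exp_Psi_incr:
  assumes "length x = n" "j < n" "0 \<le> t"
  shows "exp (Psi t (incr x j) - Psi t x) = 1 + (rho - 1) * sat t (x ! j)"
proof -
  have pos: "0 \<le> t * rho ^ (x ! j)" using assms rho_gt_1 by simp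
  have pos': "0 \<le> t * rho ^ (x ! j + 1)" using assms rho_gt_1 by simp
  have "exp (Psi t (incr x j) - Psi t x) = (1 + t * rho ^ (x ! j + 1)) / (1 + t * rho ^ (x ! j))"
    unfolding incr_def Psi_update[OF assms(1,2)] using pos pos' by (simp add: exp_diff)
  also have "\<dots> = 1 + (rho - 1) * sat t (x ! j)"
    using pos unfolding sat_def by (simp add: field_simps)
  finally show ?thesis .
qed

lemma exp_Psi_decr:
  assumes "length x = n" "j < n" "0 \<le> t" "x ! j > 0"
  shows "exp (Psi t (decr x j) - Psi t x) = 1 - (1 - 1 / rho) * sat t (x ! j)"
proof -
  obtain h where h: "x ! j = Suc h" using assms by (cases "x ! j") auto
  have pos: "0 \<le> t * rho ^ h" "0 \<le> t * rho ^ Suc h" using assms rho_gt_1 by simp_all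
  have "exp (Psi t (decr x j) - Psi t x) = (1 + t * rho ^ h) / (1 + t * rho ^ Suc h)"
    unfolding decr_def Psi_update[OF assms(1,2)] using pos h by (simp add: exp_diff)
  also have "\<dots> = 1 - (1 - 1 / rho) * sat t (x ! j)"
  proof -
    define z where "z = t * rho ^ h"
    have "1 + rho * z \<noteq> 0" using pos by (simp add: z_def mult_ac)
    then have "(1 + z) / (1 + rho * z) = 1 - (rho - 1) * z / (1 + rho * z)"
      by (simp add: field_simps)
    also have "(rho - 1) * z = (1 - 1 / rho) * (rho * z)"
      using rho_gt_1 by (simp add: field_simps)
    finally show ?thesis unfolding sat_def h by (simp add: z_def mult_ac)
  qed
  finally show ?thesis .
qed

definition mean_sat :: "real \<Rightarrow> nat list \<Rightarrow> real" where
  "mean_sat t x = (\<Sum>j<n. sat t (x ! j)) / real n"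

lemma mean_sat_nonneg: "0 \<le> t \<Longrightarrow> 0 \<le> mean_sat t x"
  unfolding mean_sat_def by (simp add: sum_nonneg sat_nonneg)

text \<open>Joining the shortest of several queues is dominated by joining the first of them, because the
  increment is monotone in the queue length.\<close>

lemma avg_exp_Psi:
  assumes x: "length x = n" and t: "0 \<le> t"
  shows "avg (\<lambda>\<omega>. exp (Psi t (step x \<omega>) - Psi t x)) \<le> 1 - eta * mean_sat t x + t"
proof -
  define m where "m = mean_sat t x"
  have n: "0 < real n" using n_pos by simp
  have "(\<Sum>js\<in>tuples n d. exp (Psi t (step x (Inl js)) - Psi t x))
      \<le> (\<Sum>js\<in>tuples n d. 1 + (rho - 1) * sat t (x ! (js ! 0)))"
  proof (rule sum_mono)
    fix js assume js: "js \<in> tuples n d"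
    have ne: "js \<noteq> []" using js d_ge by (auto simp: tuples_def)
    have "x ! shortest x js \<le> x ! (js ! 0)"
      using ne by (simp add: f_arg_min_list_f)
    then have "sat t (x ! shortest x js) \<le> sat t (x ! (js ! 0))"
      using t by (rule_tac sat_mono)
    then show "exp (Psi t (step x (Inl js)) - Psi t x) \<le> 1 + (rho - 1) * sat t (x ! (js ! 0))"
      using exp_Psi_incr[OF x shortest_less[OF js] t] rho_gt_1 by simp
  qed
  also have "\<dots> = real n ^ d + (rho - 1) * (real n ^ (d - 1) * (\<Sum>k<n. sat t (x ! k)))"
    using d_ge sum_tuples_hd[of d "\<lambda>k. sat t (x ! k)" n]
    by (simp add: sum.distrib sum_distrib_left[symmetric] card_tuples)
  also have "\<dots> = real n ^ d * (1 + (rho - 1) * m)"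
    using n d_ge by (simp add: m_def mean_sat_def field_simps power_eq_if)
  finally have arr: "(\<Sum>js\<in>tuples n d. exp (Psi t (step x (Inl js)) - Psi t x)) / real n ^ d
      \<le> 1 + (rho - 1) * m"
    using n by (simp add: divide_le_eq mult.commute)
  \<comment> \<open>An empty queue does not shrink although the bound credits it with a decrease;
    that credit is at most \<open>sat t 0\<close>, hence at most t. The summand t repays it and is
    the only source term.\<close>
  have "(\<Sum>i<n. exp (Psi t (step x (Inr i)) - Psi t x))
      \<le> (\<Sum>i<n. 1 - (1 - 1 / rho) * sat t (x ! i) + t)"
  proof (rule sum_mono)
    fix i assume "i \<in> {..<n}"
    then have i: "i < n" by simp
    show "exp (Psi t (step x (Inr i)) - Psi t x) \<le> 1 - (1 - 1 / rho) * sat t (x ! i) + t"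
    proof (cases "x ! i = 0")
      case True
      have "(1 - 1 / rho) * sat t 0 \<le> 1 * sat t 0"
        using rho_gt_1 by (intro mult_right_mono sat_nonneg t) auto
      then show ?thesis
        using True sat_0_le[OF t] by (simp add: decr_eq_self)
    next
      case False
      then show ?thesis using exp_Psi_decr[OF x i t] t by simp
    qed
  qed
  also have "\<dots> = real n * (1 - (1 - 1 / rho) * m + t)"
  proof -
    have "real n * m = (\<Sum>k<n. sat t (x ! k))" using n by (simp add: m_def mean_sat_def)
    moreover have "(\<Sum>i<n. 1 - k * sat t (x ! i) + t)
        = real n - k * (\<Sum>k<n. sat t (x ! k)) + real n * t" for k
      by (simp add: sum.distrib sum_subtractf sum_distrib_left[symmetric])
    moreover have "real n - k * (real n * m) + real n * t = real n * (1 - k * m + t)" for k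
      by (simp add: algebra_simps)
    ultimately show ?thesis by metis
  qed
  finally have dep: "(\<Sum>i<n. exp (Psi t (step x (Inr i)) - Psi t x)) / real n
      \<le> 1 - (1 - 1 / rho) * m + t"
    using n by (simp add: divide_le_eq mult.commute)
  have "avg (\<lambda>\<omega>. exp (Psi t (step x \<omega>) - Psi t x))
      \<le> lam / (1 + lam) * (1 + (rho - 1) * m) + 1 / (1 + lam) * (1 - (1 - 1 / rho) * m + t)"
    unfolding avg_split using arr dep lam_pos by (intro add_mono mult_left_mono) auto
  also have "\<dots> = (lam + 1) / (1 + lam) + (lam * (rho - 1) - (1 - 1 / rho)) / (1 + lam) * m
      + t / (1 + lam)"
  proof -
    define k where "k = 1 / rho"
    show ?thesis
      unfolding k_def[symmetric] times_divide_eq_left times_divide_eq_right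
        add_divide_distrib[symmetric] by (simp add: algebra_simps)
  qed
  also have "\<dots> \<le> 1 - eta * m + t"
    unfolding eta_eq using lam_pos t by (simp add: divide_le_eq algebra_simps)
  finally show ?thesis by (simp add: m_def)
qed

text \<open>Since \<open>sat\<close> is the derivative in ln t, lowering ln t by about c / n costs
  about c * mean_sat. The factor 2 covers the change of \<open>sat\<close> on the way, as the new
  parameter is at least t / 2.\<close>

lemma Psi_shrink:
  assumes t: "0 \<le> t" and c: "0 < c" "c \<le> eta / 4"
  shows "Psi t x \<le> Psi (t * (1 - c / real n)) x + 2 * c * mean_sat t x"
proof -
  define s where "s = 1 - c / real n"
  have n: "1 \<le> real n" using n_pos by simp
  have "c / real n \<le> c / 1" using n c by (intro divide_left_mono) auto
  then have s: "1 / 2 \<le> s" "s \<le> 1" using c eta_le_half n by (auto simp: s_def)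
  have "Psi t x - Psi (t * s) x \<le> (\<Sum>j<n. 2 * (1 - s) * sat t (x ! j))"
    unfolding Psi_def sum_subtractf[symmetric]
  proof (rule sum_mono)
    fix j
    define z where "z = t * rho ^ (x ! j)"
    have z: "0 \<le> z" using t rho_gt_1 by (simp add: z_def)
    have zs: "z / 2 \<le> z * s" using mult_left_mono[OF s(1) z] by simp
    have pos: "0 < 1 + z * s" using z zs by linarith
    have "ln (1 + z) - ln (1 + z * s) = ln ((1 + z) / (1 + z * s))"
      using z pos by (simp add: ln_div)
    also have "\<dots> \<le> (1 + z) / (1 + z * s) - 1"
      using z pos by (intro ln_le_minus_one) auto
    also have "\<dots> = z * (1 - s) / (1 + z * s)"
      using pos by (simp add: field_simps)
    also have "\<dots> \<le> z * (1 - s) / ((1 + z) / 2)"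
      using z zs s pos by (intro divide_left_mono mult_pos_pos) auto
    also have "\<dots> = 2 * (1 - s) * (z / (1 + z))"
      by simp
    finally show "ln (1 + t * rho ^ (x ! j)) - ln (1 + t * s * rho ^ (x ! j))
        \<le> 2 * (1 - s) * sat t (x ! j)"
      by (simp add: sat_def z_def mult_ac)
  qed
  also have "\<dots> = 2 * c * mean_sat t x"
    unfolding sum_distrib_left[symmetric] by (simp add: mean_sat_def s_def)
  finally show ?thesis by (simp add: s_def)
qed

text \<open>Convexity of exp carries the drift over to every power between 0 and 1. Lowering t
  spends at most half of eta * mean_sat; the half that is left will pay for the variance.\<close>

lemma avg_exp_Psi_le:
  assumes x: "length x = n" and t: "0 \<le> t" and c: "0 < c" "c \<le> eta / 4"
    and \<theta>: "0 \<le> \<theta>" "\<theta> \<le> 1"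
  shows "avg (\<lambda>\<omega>. exp (\<theta> * Psi t (step x \<omega>)))
    \<le> exp (\<theta> * (Psi (t * (1 - c / real n)) x - eta / 2 * mean_sat t x + t))"
proof -
  have *: "exp (\<theta> * a) \<le> 1 + \<theta> * (exp a - 1)" for a :: real
    using convex_onD[OF exp_convex, of \<theta> 0 a] \<theta> by (simp add: algebra_simps)
  have "avg (\<lambda>\<omega>. exp (\<theta> * Psi t (step x \<omega>)))
      = exp (\<theta> * Psi t x) * avg (\<lambda>\<omega>. exp (\<theta> * (Psi t (step x \<omega>) - Psi t x)))"
    unfolding avg_cmult[symmetric] by (simp add: exp_add[symmetric] algebra_simps)
  also have "\<dots> \<le> exp (\<theta> * Psi t x) *
      avg (\<lambda>\<omega>. 1 + \<theta> * (exp (Psi t (step x \<omega>) - Psi t x) - 1))"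
    by (intro mult_left_mono avg_mono *) auto
  also have "avg (\<lambda>\<omega>. 1 + \<theta> * (exp (Psi t (step x \<omega>) - Psi t x) - 1))
      = 1 + \<theta> * (avg (\<lambda>\<omega>. exp (Psi t (step x \<omega>) - Psi t x)) - 1)"
    by (simp add: avg_add avg_cmult avg_diff)
  also have "\<dots> \<le> 1 + \<theta> * (- eta * mean_sat t x + t)"
    using avg_exp_Psi[OF x t] \<theta> by (intro add_left_mono mult_left_mono) auto
  also have "\<dots> \<le> exp (\<theta> * (- eta * mean_sat t x + t))"
    by (rule exp_ge_add_one_self)
  also have "exp (\<theta> * Psi t x) * \<dots> = exp (\<theta> * (Psi t x - eta * mean_sat t x + t))"
    by (simp add: exp_add[symmetric] algebra_simps)
  also have "\<dots> \<le> exp (\<theta> * (Psi (t * (1 - c / real n)) x - eta / 2 * mean_sat t x + t))"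
  proof -
    have "2 * c * mean_sat t x \<le> eta / 2 * mean_sat t x"
      using c by (intro mult_right_mono mean_sat_nonneg t) auto
    then show ?thesis
      using Psi_shrink[OF t c, of x] \<theta> by (intro exp_le_cancel_iff[THEN iffD2] mult_left_mono) auto
  qed
  finally show ?thesis by simp
qed

lemma shrink_bounds:
  assumes "0 < c" "c \<le> eta / 4"
  shows "0 < 1 - c / real n" "1 - c / real n < 1"
proof -
  have "c / real n \<le> c / 1" using n_pos assms by (intro divide_left_mono) auto
  then show "0 < 1 - c / real n" using assms eta_le_half by linarith
  show "1 - c / real n < 1" using assms n_pos by simp
qed

lemma sum_shrink_le:
  assumes "0 < c" "c \<le> eta / 4"
  shows "(\<Sum>i<T. (1 - c / real n) ^ i) \<le> real n / c"
proof -
  define s where "s = 1 - c / real n"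
  have s: "0 < s" "s < 1" using shrink_bounds[OF assms] by (auto simp: s_def)
  have "(\<Sum>i<T. s ^ i) = (1 - s ^ T) / (1 - s)"
    using s by (simp add: sum_gp_strict)
  also have "\<dots> \<le> 1 / (1 - s)"
    using s by (intro divide_right_mono) auto
  also have "\<dots> = real n / c"
    by (simp add: s_def)
  finally show ?thesis by (simp add: s_def)
qed

lemma power_total_le_exp_Psi:
  assumes "length x = n"
  shows "rho ^ total x \<le> exp (Psi 1 x)"
proof -
  have "rho ^ total x = (\<Prod>j<n. rho ^ (x ! j))"
    using assms by (simp add: total_def power_sum)
  also have "\<dots> \<le> (\<Prod>j<n. 1 + 1 * rho ^ (x ! j))"
    using rho_gt_1 by (intro prod_mono) auto
  also have "\<dots> = exp (Psi 1 x)"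
    unfolding Psi_def exp_sum[OF finite_lessThan] using rho_gt_1 by (intro prod.cong) (auto simp: add_pos_pos)
  finally show ?thesis .
qed

text \<open>Solves CS * ln rho = 4 / eta + 1: an exponential moment exp (4 * n / eta) of rho ^ total
  then leaves a tail exp (- n) beyond CS * n customers.\<close>

definition CS :: real where "CS = (4 / eta + 1) / ln rho"

lemma CS_pos: "0 < CS"
  using eta_pos rho_gt_1 by (simp add: CS_def add_pos_pos)

end

lemma (in stationary_supermarket) expectation_mono:
  fixes g h :: "nat list \<Rightarrow> real"
  assumes "integrable p g" "integrable p h" "\<And>x. length x = n \<Longrightarrow> g x \<le> h x"
  shows "measure_pmf.expectation p g \<le> measure_pmf.expectation p h"
  using assms length_of_set_pmf by (intro integral_mono_AE) (auto simp: AE_measure_pmf_iff)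

lemma integrable_min_exp:
  fixes p :: "'a pmf"
  shows "integrable p (\<lambda>x. min (exp (F x)) (exp N :: real))"
  by (intro measure_pmf.integrable_const_bound[where B = "exp N"]) (auto simp: abs_le_iff)

lemma integrable_indicator_pmf:
  fixes p :: "'a pmf"
  shows "integrable p (indicator A :: 'a \<Rightarrow> real)"
  by (intro measure_pmf.integrable_const_bound[where B = 1]) (auto simp: indicator_def)

section \<open>Exponential moments and tails of the number of customers\<close>

context stationary_supermarket
begin

text \<open>Because of the cutoff at \<open>exp N\<close> an exceptional set costs only its probability times
  \<open>exp N\<close>.\<close>

lemma expectation_min_trans:
  assumes "\<And>x. length x = n \<Longrightarrow> x \<notin> B \<Longrightarrow> trans (\<lambda>y. exp (F y)) x \<le> exp (G x)"
  shows "measure_pmf.expectation p (\<lambda>x. min (exp (F x)) (exp N))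
    \<le> measure_pmf.expectation p (\<lambda>x. min (exp (G x)) (exp N)) + exp N * measure_pmf.prob p B"
proof -
  have "measure_pmf.expectation p (\<lambda>x. min (exp (F x)) (exp N))
      = measure_pmf.expectation p (trans (\<lambda>x. min (exp (F x)) (exp N)))"
    by (simp add: expectation_trans integrable_min_exp)
  also have "\<dots> \<le> measure_pmf.expectation p (\<lambda>x. min (exp (G x)) (exp N) + exp N * indicator B x)"
  proof (rule expectation_mono)
    fix x :: "nat list" assume x: "length x = n"
    have "trans (\<lambda>x. min (exp (F x)) (exp N)) x \<le> trans (\<lambda>x. exp (F x)) x"
      unfolding trans_def by (intro avg_mono) auto
    moreover have "trans (\<lambda>x. min (exp (F x)) (exp N)) x \<le> trans (\<lambda>x. exp N) x"
      unfolding trans_def by (intro avg_mono) auto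
    ultimately show "trans (\<lambda>x. min (exp (F x)) (exp N)) x
        \<le> min (exp (G x)) (exp N) + exp N * indicator B x"
      using assms[OF x] by (cases "x \<in> B") (auto simp: add_increasing)
  qed (intro integrable_trans integrable_min_exp integrable_indicator_pmf
      Bochner_Integration.integrable_add Bochner_Integration.integrable_mult_right)+
  also have "\<dots> = measure_pmf.expectation p (\<lambda>x. min (exp (G x)) (exp N))
      + exp N * measure_pmf.prob p B"
    by (subst Bochner_Integration.integral_add)
      (auto simp: integrable_min_exp integrable_indicator_pmf)
  finally show ?thesis .
qed

lemma expectation_min_exp_Psi_iterate:
  assumes c: "0 < c" "c \<le> eta / 4"
  defines "s \<equiv> 1 - c / real n"
  shows "measure_pmf.expectation p (\<lambda>x. min (exp (Psi 1 x)) (exp N))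
    \<le> measure_pmf.expectation p (\<lambda>x. min (exp (Psi (s ^ T) x + (\<Sum>i<T. s ^ i))) (exp N))"
proof (induction T)
  case 0
  then show ?case by simp
next
  case (Suc T)
  have s: "0 < s" using shrink_bounds[OF c] by (simp add: s_def)
  \<comment> \<open>The drift of \<open>Psi\<close> holds in every state, so the exceptional set is
    empty.\<close>
  have "measure_pmf.expectation p (\<lambda>x. min (exp (Psi (s ^ T) x + (\<Sum>i<T. s ^ i))) (exp N))
    \<le> measure_pmf.expectation p (\<lambda>x. min (exp (Psi (s ^ Suc T) x + (\<Sum>i<Suc T. s ^ i))) (exp N))
      + exp N * measure_pmf.prob p {}"
  proof (rule expectation_min_trans)
    fix x :: "nat list" assume x: "length x = n"
    have "trans (\<lambda>y. exp (Psi (s ^ T) y + (\<Sum>i<T. s ^ i))) x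
        = exp (\<Sum>i<T. s ^ i) * avg (\<lambda>\<omega>. exp (1 * Psi (s ^ T) (step x \<omega>)))"
      unfolding trans_def avg_cmult[symmetric] by (simp add: exp_add mult.commute)
    also have "\<dots> \<le> exp (\<Sum>i<T. s ^ i) *
        exp (1 * (Psi (s ^ T * s) x - eta / 2 * mean_sat (s ^ T) x + s ^ T))"
      using avg_exp_Psi_le[OF x _ c, of "s ^ T" 1] s by (intro mult_left_mono) (auto simp: s_def)
    also have "\<dots> \<le> exp (\<Sum>i<T. s ^ i) * exp (Psi (s ^ Suc T) x + s ^ T)"
      using mean_sat_nonneg[of "s ^ T" x] s eta_pos by (simp add: mult.commute)
    also have "\<dots> = exp (Psi (s ^ Suc T) x + (\<Sum>i<Suc T. s ^ i))"
      by (simp add: exp_add[symmetric])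
    finally show "trans (\<lambda>y. exp (Psi (s ^ T) y + (\<Sum>i<T. s ^ i))) x
        \<le> exp (Psi (s ^ Suc T) x + (\<Sum>i<Suc T. s ^ i))" .
  qed
  with Suc show ?case by simp
qed

text \<open>The left side does not involve the number T of steps. As T grows, Psi (s ^ T) tends to 0
  pointwise, and only the geometric sum of the sources, at most n / c = 4 * n / eta, survives; the
  cutoff is the dominating function.\<close>

lemma expectation_min_exp_Psi:
  "measure_pmf.expectation p (\<lambda>x. min (exp (Psi 1 x)) (exp N)) \<le> exp (4 * real n / eta)"
proof -
  define c where "c = eta / 4"
  have c: "0 < c" "c \<le> eta / 4" using eta_pos by (auto simp: c_def)
  define s where "s = 1 - c / real n"
  have s: "0 < s" "s < 1" using shrink_bounds[OF c] by (auto simp: s_def)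
  have "(\<lambda>T. measure_pmf.expectation p (\<lambda>x. min (exp (Psi (s ^ T) x + real n / c)) (exp N)))
      \<longlonglongrightarrow> measure_pmf.expectation p (\<lambda>x. min (exp (0 + real n / c)) (exp N))"
  proof (rule integral_dominated_convergence[where w = "\<lambda>_. exp N"])
    have "(\<lambda>T. Psi (s ^ T) x) \<longlonglongrightarrow> (\<Sum>j<n. ln (1 + 0 * rho ^ (x ! j)))" for x
      unfolding Psi_def using s
      by (intro tendsto_sum tendsto_ln tendsto_add tendsto_mult tendsto_const LIMSEQ_power_zero) auto
    then have "(\<lambda>T. Psi (s ^ T) x) \<longlonglongrightarrow> 0" for x by simp
    then show "AE x in p. (\<lambda>T. min (exp (Psi (s ^ T) x + real n / c)) (exp N))
        \<longlonglongrightarrow> min (exp (0 + real n / c)) (exp N)"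
      by (intro always_eventually allI tendsto_min tendsto_exp tendsto_add tendsto_const)
  qed auto
  moreover have "measure_pmf.expectation p (\<lambda>x. min (exp (Psi 1 x)) (exp N))
      \<le> measure_pmf.expectation p (\<lambda>x. min (exp (Psi (s ^ T) x + real n / c)) (exp N))" for T
  proof -
    have "measure_pmf.expectation p (\<lambda>x. min (exp (Psi (s ^ T) x + (\<Sum>i<T. s ^ i))) (exp N))
        \<le> measure_pmf.expectation p (\<lambda>x. min (exp (Psi (s ^ T) x + real n / c)) (exp N))"
      using sum_shrink_le[OF c, of T]
      by (intro expectation_mono integrable_min_exp min.mono) (auto simp: s_def)
    then show ?thesis
      using expectation_min_exp_Psi_iterate[OF c, of N T] unfolding s_def by linarith
  qed
  ultimately have "measure_pmf.expectation p (\<lambda>x. min (exp (Psi 1 x)) (exp N))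
      \<le> measure_pmf.expectation p (\<lambda>x. min (exp (0 + real n / c)) (exp N))"
    by (intro LIMSEQ_le_const) auto
  also have "\<dots> \<le> exp (real n / c)"
    by simp
  finally show ?thesis by (simp add: c_def field_simps)
qed

text \<open>The bound with cutoff is uniform in the cutoff, so monotone convergence gives
  integrability together with the moment bound.\<close>

lemma integrable_exp_Psi: "integrable p (\<lambda>x. exp (Psi 1 x))"
  and expectation_exp_Psi:
    "measure_pmf.expectation p (\<lambda>x. exp (Psi 1 x)) \<le> exp (4 * real n / eta)"
proof -
  define I where "I = (\<lambda>N. measure_pmf.expectation p (\<lambda>x. min (exp (Psi 1 x)) (exp (real N))))"
  have I_le: "I N \<le> exp (4 * real n / eta)" for N
    unfolding I_def by (rule expectation_min_exp_Psi)
  have "incseq I"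
    unfolding I_def
    by (intro monoI expectation_mono integrable_min_exp min.mono) auto
  then obtain L where L: "I \<longlonglongrightarrow> L" "\<And>N. I N \<le> L"
    using incseq_convergent[of I] I_le by blast
  have lim: "(\<lambda>N. min (exp (Psi 1 x)) (exp (real N))) \<longlonglongrightarrow> exp (Psi 1 x)" for x
  proof (rule tendsto_eventually)
    obtain N0 :: nat where "Psi 1 x \<le> real N0" using real_arch_simple by blast
    then show "\<forall>\<^sub>F N in sequentially. min (exp (Psi 1 x)) (exp (real N)) = exp (Psi 1 x)"
      by (intro eventually_sequentiallyI[of N0]) auto
  qed
  have mono: "mono (\<lambda>N. min (exp (Psi 1 x)) (exp (real N)))" for x
    by (intro monoI min.mono) auto
  show "integrable p (\<lambda>x. exp (Psi 1 x))"
    by (rule integrable_monotone_convergence[where x = L, OF integrable_min_exp])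
      (use lim mono L in \<open>auto simp: I_def\<close>)
  have "measure_pmf.expectation p (\<lambda>x. exp (Psi 1 x)) = L"
    by (rule integral_monotone_convergence[where x = L, OF integrable_min_exp])
      (use lim mono L in \<open>auto simp: I_def\<close>)
  also have "L \<le> exp (4 * real n / eta)"
    using L(1) I_le by (intro LIMSEQ_le_const2) auto
  finally show "measure_pmf.expectation p (\<lambda>x. exp (Psi 1 x)) \<le> exp (4 * real n / eta)" .
qed

lemma exp_total_le:
  assumes "length x = n"
  shows "exp (real (total x) * ln rho) \<le> exp (Psi 1 x)"
proof -
  have "exp (real (total x) * ln rho) = rho ^ total x"
    using rho_gt_1 by (simp add: exp_of_nat_mult)
  with power_total_le_exp_Psi[OF assms] show ?thesis by simp
qed

lemma integrable_total: "integrable p (\<lambda>x. real (total x))"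
proof (rule Bochner_Integration.integrable_bound)
  show "integrable p (\<lambda>x. exp (Psi 1 x) / ln rho)"
    using integrable_exp_Psi by simp
  show "AE x in p. norm (real (total x)) \<le> norm (exp (Psi 1 x) / ln rho)"
  proof (intro AE_pmfI)
    fix x assume "x \<in> set_pmf p"
    then have "exp (real (total x) * ln rho) \<le> exp (Psi 1 x)"
      by (intro exp_total_le length_of_set_pmf)
    moreover have "1 + real (total x) * ln rho \<le> exp (real (total x) * ln rho)"
      by (rule exp_ge_add_one_self)
    ultimately have "real (total x) * ln rho \<le> exp (Psi 1 x)" by linarith
    then show "norm (real (total x)) \<le> norm (exp (Psi 1 x) / ln rho)"
      using rho_gt_1 by (simp add: pos_le_divide_eq del: exp_le_cancel_iff)
  qed
qed auto

text \<open>Let y be the excess of total * ln rho over 4 * n / eta. Beyond CS * n it is at least n,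
  so exp (- n) * exp y is at least 1 and the number of customers is at most CS * y. Both estimates
  are integrated below.\<close>

lemma total_tail_pointwise:
  assumes x: "length x = n" and "real (total x) > CS * real n"
  shows "1 \<le> exp (- real n) * (exp (- 4 * real n / eta) * exp (Psi 1 x))"
    and "real (total x) \<le> CS * (exp (- 4 * real n / eta) * exp (Psi 1 x))"
proof -
  have ln: "0 < ln rho" using rho_gt_1 by simp
  define y where "y = real (total x) * ln rho - 4 * real n / eta"
  have "CS * real n * ln rho \<le> real (total x) * ln rho"
    using assms ln by (intro mult_right_mono) auto
  moreover have "CS * real n * ln rho = 4 * real n / eta + real n"
    using ln by (simp add: CS_def field_simps)
  ultimately have y: "real n \<le> y" by (simp add: y_def)
  have e: "exp y \<le> exp (- 4 * real n / eta) * exp (Psi 1 x)"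
    using exp_total_le[OF x] by (simp add: y_def exp_diff exp_minus field_simps)
  have "1 \<le> exp (- real n) * exp y"
    using y by (simp add: exp_add[symmetric])
  also have "\<dots> \<le> exp (- real n) * (exp (- 4 * real n / eta) * exp (Psi 1 x))"
    using e by (intro mult_left_mono) auto
  finally show "1 \<le> exp (- real n) * (exp (- 4 * real n / eta) * exp (Psi 1 x))" .
  have "real (total x) * ln rho = y + 4 / eta * real n" by (simp add: y_def)
  also have "\<dots> \<le> y + 4 / eta * y"
    using y eta_pos by (intro add_left_mono mult_left_mono) auto
  also have "\<dots> = (4 / eta + 1) * y" by (simp add: algebra_simps)
  also have "\<dots> \<le> (4 / eta + 1) * exp y"
  proof (rule mult_left_mono)
    show "y \<le> exp y" using exp_ge_add_one_self[of y] by linarith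
  qed (use eta_pos in \<open>simp add: add_nonneg_nonneg\<close>)
  finally have "real (total x) \<le> CS * exp y"
    using ln by (simp add: CS_def field_simps)
  also have "\<dots> \<le> CS * (exp (- 4 * real n / eta) * exp (Psi 1 x))"
    using e CS_pos by (intro mult_left_mono) auto
  finally show "real (total x) \<le> CS * (exp (- 4 * real n / eta) * exp (Psi 1 x))" .
qed

lemma expectation_normalized_le:
  "measure_pmf.expectation p (\<lambda>x. exp (- 4 * real n / eta) * exp (Psi 1 x)) \<le> 1"
proof -
  have "exp (- 4 * real n / eta) * measure_pmf.expectation p (\<lambda>x. exp (Psi 1 x))
      \<le> exp (- 4 * real n / eta) * exp (4 * real n / eta)"
    using expectation_exp_Psi by (intro mult_left_mono) auto
  also have "\<dots> = 1" by (simp add: exp_add[symmetric])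
  finally show ?thesis by simp
qed

lemma prob_total_le: "measure_pmf.prob p {x. real (total x) > CS * real n} \<le> exp (- real n)"
proof -
  have "measure_pmf.prob p {x. real (total x) > CS * real n}
      = measure_pmf.expectation p (indicator {x. real (total x) > CS * real n})"
    by simp
  also have "\<dots> \<le> measure_pmf.expectation p
      (\<lambda>x. exp (- real n) * (exp (- 4 * real n / eta) * exp (Psi 1 x)))"
    using total_tail_pointwise(1) integrable_exp_Psi
    by (intro expectation_mono integrable_indicator_pmf) (auto simp: indicator_def)
  also have "\<dots> = exp (- real n) *
      measure_pmf.expectation p (\<lambda>x. exp (- 4 * real n / eta) * exp (Psi 1 x))"
    by simp
  also have "\<dots> \<le> exp (- real n) * 1"
    using expectation_normalized_le by (intro mult_left_mono) auto
  finally show ?thesis by simp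
qed

lemma expectation_total_tail:
  "measure_pmf.expectation p (\<lambda>x. real (total x) * indicator {x. real (total x) > CS * real n} x)
    \<le> CS"
proof -
  have "measure_pmf.expectation p
        (\<lambda>x. real (total x) * indicator {x. real (total x) > CS * real n} x)
      \<le> measure_pmf.expectation p (\<lambda>x. CS * (exp (- 4 * real n / eta) * exp (Psi 1 x)))"
    using total_tail_pointwise(2) integrable_exp_Psi CS_pos
    by (intro expectation_mono integrable_real_mult_indicator integrable_total)
      (auto simp: indicator_def)
  also have "\<dots> = CS * measure_pmf.expectation p (\<lambda>x. exp (- 4 * real n / eta) * exp (Psi 1 x))"
    by simp
  also have "\<dots> \<le> CS * 1"
    using expectation_normalized_le CS_pos by (intro mult_left_mono) auto
  finally show ?thesis by simp
qed

end

section \<open>Propagation of a discrepancy of one customer\<close>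

text \<open>A queue that was not chosen only becomes longer. The induction follows the recursion of
  \<open>arg_min_list\<close>, so that the tie rule is respected.\<close>

lemma shortest_incr_other:
  assumes "js \<noteq> []" "set js \<subseteq> {..<length x}" "j < length x" "shortest x js \<noteq> j"
  shows "shortest (incr x j) js = shortest x js"
  using assms
proof (induction js rule: induct_list012)
  case (3 a b js)
  define m where "m = shortest x (b # js)"
  define m' where "m' = shortest (incr x j) (b # js)"
  show ?case
  proof (cases "x ! a \<le> x ! m")
    case True
    then have a: "a \<noteq> j" using 3 by (auto simp: m_def Let_def)
    \<comment> \<open>The choice within the tail may change here, so only lengths are compared; the
      head still wins a tie.\<close>
    have "m' \<in> set (b # js)" unfolding m'_def by (rule arg_min_list_in) simp
    then have "x ! m \<le> x ! m'"
      unfolding m_def by (subst f_arg_min_list_f) auto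
    also have "\<dots> \<le> incr x j ! m'" using 3 by (simp add: nth_incr)
    finally show ?thesis
      using True a 3 by (simp add: m_def m'_def Let_def nth_incr)
  next
    case False
    then have "m \<noteq> j" using 3 by (auto simp: m_def Let_def)
    then have "m' = m" using 3 by (auto simp: m_def m'_def)
    then show ?thesis
      using False \<open>m \<noteq> j\<close> 3 by (auto simp: m_def m'_def Let_def nth_incr)
  qed
qed auto

text \<open>Queue j stays in the list with length x ! j + 1, so whatever is chosen instead is not
  longer than that.\<close>

lemma shortest_incr_self:
  assumes "js \<noteq> []" "set js \<subseteq> {..<length x}" "j < length x" "shortest x js = j"
  shows "x ! shortest (incr x j) js \<le> x ! j + 1"
proof -
  have j: "j \<in> set js" using assms arg_min_list_in by metis
  have "x ! shortest (incr x j) js \<le> incr x j ! shortest (incr x j) js"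
    using assms by (simp add: nth_incr)
  also have "\<dots> \<le> incr x j ! j"
    using assms j by (simp add: f_arg_min_list_f)
  finally show ?thesis using assms by (simp add: nth_incr)
qed

lemma incr_commute: "j \<noteq> k \<Longrightarrow> incr (incr x j) k = incr (incr x k) j"
  by (simp add: incr_def list_update_swap)

section \<open>Coupling of two states that differ by one customer\<close>

context supermarket
begin

text \<open>A bound for w at the queue that holds the extra customer after the event. The value 0
  stands for merged copies; if an arrival picks j, length x ! j + 1 is charged wherever the extra
  customer ends up.\<close>

definition moved :: "(nat \<Rightarrow> real) \<Rightarrow> nat list \<Rightarrow> nat \<Rightarrow> nat list + nat \<Rightarrow> real" where
  "moved w x j \<omega> = (case \<omega> of
     Inl js \<Rightarrow> if shortest x js = j then w (x ! j + 1) else w (x ! j)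
   | Inr i \<Rightarrow> if i = j then (if x ! j = 0 then 0 else w (x ! j - 1)) else w (x ! j))"

text \<open>Two coupled copies that differ by one customer either merge or still differ by one customer,
  possibly in another queue. The customer moves only to a queue at most one longer.\<close>

lemma coupled_step:
  assumes x: "length x = n" and j: "j < n" and \<omega>: "\<omega> \<in> events"
  obtains (merge) "step (incr x j) \<omega> = step x \<omega>"
  | (adjacent) m where "m < n" "step (incr x j) \<omega> = incr (step x \<omega>) m"
      "\<And>w. mono w \<Longrightarrow> w (step x \<omega> ! m) \<le> moved w x j \<omega>"
  using \<omega>
proof (cases rule: event_cases)
  case (arr js)
  define k where "k = shortest x js"
  define k' where "k' = shortest (incr x j) js"
  have kn: "k < n" "k' < n"
    using arr arg_min_list_in[of js] unfolding k_def k'_def by (meson lessThan_iff subsetD)+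
  show ?thesis
  proof (cases "k = j")
    case False
    then have "k' = k"
      unfolding k_def k'_def using arr x j by (intro shortest_incr_other) auto
    then have "step (incr x j) \<omega> = incr (step x \<omega>) j"
      using arr False by (simp add: k_def[symmetric] k'_def[symmetric] incr_commute)
    moreover have "step x \<omega> ! j = x ! j"
      using arr False x j kn by (simp add: k_def[symmetric] nth_incr)
    ultimately show ?thesis
      using False arr j by (intro adjacent[of j]) (auto simp: moved_def k_def)
  next
    case True
    have le: "x ! k' \<le> x ! j + 1"
      using True unfolding k'_def k_def using arr x j by (intro shortest_incr_self) auto
    \<comment> \<open>The smaller copy puts the arrival into j and the larger one into k', so the
      customer in k' becomes the extra one.\<close>
    have "step (incr x j) \<omega> = incr (step x \<omega>) k'"
      using True arr by (simp add: k_def[symmetric] k'_def[symmetric])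
    moreover have "step x \<omega> ! k' \<le> x ! j + 1"
      using le arr True x j by (simp add: k_def[symmetric] nth_incr)
    ultimately show ?thesis
      using True arr kn by (intro adjacent[of k']) (auto simp: moved_def k_def dest: monoD)
  qed
next
  case (dep i)
  show ?thesis
  proof (cases "i = j")
    case False
    then have "step (incr x j) \<omega> = incr (step x \<omega>) j"
      using dep x j by (simp add: incr_def decr_def list_update_swap)
    then show ?thesis
      using False dep x j by (intro adjacent[of j]) (auto simp: moved_def nth_decr)
  next
    case True
    have y: "step (incr x j) \<omega> = x"
      using True dep x j by (simp add: incr_def decr_def)
    show ?thesis
    proof (cases "x ! j = 0")
      case True
      then have "step x \<omega> = x" using dep \<open>i = j\<close> by (simp add: decr_eq_self)
      with y show ?thesis by (intro merge) simp
    next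
      case False
      then show ?thesis
        using y True dep x j
        by (intro adjacent[of j]) (auto simp: moved_def nth_decr incr_decr)
    qed
  qed
qed

text \<open>The part of the bound that depends on the queue of the extra customer is transported by
  \<open>moved\<close>, the part that depends on the whole state by \<open>trans\<close>.\<close>

lemma trans_incr_diff_le:
  assumes g: "\<And>z m. length z = n \<Longrightarrow> m < n \<Longrightarrow> \<bar>g (incr z m) - g z\<bar> \<le> a * w (z ! m) + b z"
    and a: "0 \<le> a" and b: "\<And>z. 0 \<le> b z" and w: "mono w" "\<And>h. 0 \<le> w h"
    and x: "length x = n" and j: "j < n"
  shows "\<bar>trans g (incr x j) - trans g x\<bar> \<le> a * avg (moved w x j) + trans b x"
proof -
  have "\<bar>trans g (incr x j) - trans g x\<bar> \<le> avg (\<lambda>\<omega>. \<bar>g (step (incr x j) \<omega>) - g (step x \<omega>)\<bar>)"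
    unfolding trans_def avg_diff[symmetric] by (rule abs_avg_le)
  also have "\<dots> \<le> avg (\<lambda>\<omega>. a * moved w x j \<omega> + b (step x \<omega>))"
  proof (rule avg_mono)
    fix \<omega> assume \<omega>: "\<omega> \<in> events"
    have nn: "0 \<le> moved w x j \<omega>" using w by (auto simp: moved_def split: sum.splits)
    from x j \<omega> show "\<bar>g (step (incr x j) \<omega>) - g (step x \<omega>)\<bar> \<le> a * moved w x j \<omega> + b (step x \<omega>)"
    proof (cases rule: coupled_step)
      case merge
      then show ?thesis using a b nn by simp
    next
      case (adjacent m)
      have "\<bar>g (step (incr x j) \<omega>) - g (step x \<omega>)\<bar> \<le> a * w (step x \<omega> ! m) + b (step x \<omega>)"
        using g[of "step x \<omega>" m] adjacent x by simp
      also have "\<dots> \<le> a * moved w x j \<omega> + b (step x \<omega>)"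
        using adjacent(3)[OF w(1)] a by (intro add_right_mono mult_left_mono)
      finally show ?thesis .
    qed
  qed
  also have "\<dots> = a * avg (moved w x j) + trans b x"
    by (simp add: avg_add avg_cmult trans_def)
  finally show ?thesis .
qed

lemma avg_moved:
  assumes "j < n"
  shows "avg (moved w x j) = w (x ! j)
    + lam / (1 + lam) * (real (card {js \<in> tuples n d. shortest x js = j}) / real n ^ d)
        * (w (x ! j + 1) - w (x ! j))
    - 1 / (1 + lam) / real n * (if x ! j = 0 then w 0 else w (x ! j) - w (x ! j - 1))"
proof -
  \<comment> \<open>At an empty queue a departure merges the copies, which amounts to w (-1) =
    0.\<close>
  define D where "D = (if x ! j = 0 then w 0 else w (x ! j) - w (x ! j - 1))"
  define h where "h \<omega> = (case \<omega> of
      Inl js \<Rightarrow> if shortest x js = j then w (x ! j + 1) - w (x ! j) else 0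
    | Inr i \<Rightarrow> if i = j then - D else 0)" for \<omega> :: "nat list + nat"
  have "moved w x j = (\<lambda>\<omega>. w (x ! j) + h \<omega>)"
    by (auto simp: moved_def h_def D_def fun_eq_iff split: sum.splits)
  then have "avg (moved w x j) = w (x ! j) + avg h"
    by (simp add: avg_add)
  moreover have "(\<Sum>js\<in>tuples n d. h (Inl js))
      = real (card {js \<in> tuples n d. shortest x js = j}) * (w (x ! j + 1) - w (x ! j))"
    by (simp add: h_def sum.If_cases[OF finite_tuples] Int_def)
  moreover have "(\<Sum>i<n. h (Inr i)) = - D"
    using assms by (simp add: h_def)
  ultimately show ?thesis
    unfolding avg_split[of h] D_def[symmetric] by simp
qed

lemma card_pick_le:
  assumes "j < n"
  shows "card {js \<in> tuples n d. shortest x js = j} \<le> d * n ^ (d - 1)"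
proof -
  have "{js \<in> tuples n d. shortest x js = j} \<subseteq> (\<Union>r<d. {js \<in> tuples n d. js ! r = j})"
  proof
    fix js assume js: "js \<in> {js \<in> tuples n d. shortest x js = j}"
    then have "js \<noteq> []" "length js = d" using d_ge by (auto simp: tuples_def)
    then show "js \<in> (\<Union>r<d. {js \<in> tuples n d. js ! r = j})"
      using js arg_min_list_in[of js "\<lambda>i. x ! i"] by (auto simp: in_set_conv_nth)
  qed
  then have "card {js \<in> tuples n d. shortest x js = j}
      \<le> card (\<Union>r<d. {js \<in> tuples n d. js ! r = j})"
    by (intro card_mono) (auto simp: finite_tuples)
  also have "\<dots> \<le> (\<Sum>r<d. card {js \<in> tuples n d. js ! r = j})"
    by (rule card_UN_le) simp
  also have "\<dots> = d * n ^ (d - 1)"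
    using assms by (simp add: card_tuples_nth_eq)
  finally show ?thesis .
qed

text \<open>Here d >= 2 enters. If j is chosen, the other entries of the tuple are at least as long,
  and a single further entry, at position \<open>r'\<close>, already gives the factor card / n over
  the plain union bound.\<close>

lemma card_pick_le_longer:
  assumes "j < n"
  shows "card {js \<in> tuples n d. shortest x js = j} \<le> d * (card {k. k < n \<and> x ! j \<le> x ! k} * n ^ (d - 2))"
proof -
  define A where "A = {k. k < n \<and> x ! j \<le> x ! k}"
  define r' where "r' r = (if r = 0 then 1 else 0 :: nat)" for r :: nat
  have r': "r' r < d" "r \<noteq> r' r" for r using d_ge by (auto simp: r'_def)
  have "{js \<in> tuples n d. shortest x js = j}
      \<subseteq> (\<Union>r<d. {js \<in> tuples n d. js ! r = j \<and> js ! r' r \<in> A})"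
  proof
    fix js assume js: "js \<in> {js \<in> tuples n d. shortest x js = j}"
    then have l: "js \<noteq> []" "length js = d" "set js \<subseteq> {..<n}" using d_ge by (auto simp: tuples_def)
    then obtain r where r: "r < d" "js ! r = j"
      using js arg_min_list_in[of js "\<lambda>i. x ! i"] by (auto simp: in_set_conv_nth)
    have m: "js ! r' r \<in> set js" using l r' by auto
    then have "x ! shortest x js \<le> x ! (js ! r' r)"
      using l by (subst f_arg_min_list_f) auto
    then have "js ! r' r \<in> A" using js m l by (auto simp: A_def)
    then show "js \<in> (\<Union>r<d. {js \<in> tuples n d. js ! r = j \<and> js ! r' r \<in> A})"
      using r js by auto
  qed
  then have "card {js \<in> tuples n d. shortest x js = j}
      \<le> card (\<Union>r<d. {js \<in> tuples n d. js ! r = j \<and> js ! r' r \<in> A})"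
    by (intro card_mono) (auto simp: finite_tuples)
  also have "\<dots> \<le> (\<Sum>r<d. card {js \<in> tuples n d. js ! r = j \<and> js ! r' r \<in> A})"
    by (rule card_UN_le) simp
  also have "\<dots> = (\<Sum>r<d. card A * n ^ (d - 2))"
    using assms r' by (intro sum.cong card_tuples_nth_eq_nth_in) (auto simp: A_def)
  finally show ?thesis by (simp add: A_def)
qed

section \<open>A weight that contracts outside \<open>bad\<close>\<close>

definition h0 :: nat where "h0 = nat \<lceil>2 * real d * CS\<rceil>"

text \<open>By the choice of h0, at most CS * n customers allow at most n / (2 * d) queues of length
  h0 or more; so \<open>bad\<close> lies in the tail already bounded.\<close>

definition bad :: "nat list set" where
  "bad = {x. real n / (2 * real d) < real (card {k. k < n \<and> h0 \<le> x ! k})}"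

text \<open>The increments of \<open>W\<close>. An arrival picks a given queue with probability at
  most d / n, so below h0 the next increment is smaller by the factor 2 * d. From h0 on, outside
  \<open>bad\<close>, that probability is at most 1 / (2 * n), and growth by rho is affordable
  because lam * rho < 1. Either way arrivals gain at most half of what departures lose.\<close>

definition dl :: "nat \<Rightarrow> real" where
  "dl k = (if k \<le> h0 then (1 / (2 * real d)) ^ k else (1 / (2 * real d)) ^ h0 * rho ^ (k - h0))"

definition W :: "nat \<Rightarrow> real" where "W h = (\<Sum>k\<le>h. dl k)"

text \<open>The first entry serves lengths up to h0, where \<open>W\<close> has at most h0 + 1
  summands, none above 1; the second is the geometric series in 1 / rho, which keeps the bound W h
  <= KW * dl h inductive beyond h0.\<close>

definition KW :: real where
  "KW = max ((real h0 + 1) * (2 * real d) ^ h0) (rho / (rho - 1))"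

text \<open>The entry 1 / (4 * KW) is the contraction available for \<open>W\<close>; the entry eta
  / 4 lets \<open>Psi_shrink\<close> use the same factor, so that both decay in step.\<close>

definition rate :: real where "rate = min (eta / 4) (1 / (4 * KW))"

definition shrink :: real where "shrink = 1 - rate / real n"

lemma dl_pos: "0 < dl k"
  using d_ge rho_gt_1 by (simp add: dl_def)

lemma dl_Suc_less: "k < h0 \<Longrightarrow> dl (Suc k) = dl k / (2 * real d)"
  by (simp add: dl_def)

lemma dl_Suc_ge: "h0 \<le> k \<Longrightarrow> dl (Suc k) = rho * dl k"
  by (auto simp: dl_def Suc_diff_le)

lemma dl_le_rho: "dl k \<le> rho ^ k"
proof (induction k)
  case 0
  then show ?case by (simp add: dl_def)
next
  case (Suc k)
  have "dl (Suc k) \<le> rho * dl k"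
  proof (cases "k < h0")
    case True
    have "1 / (2 * real d) \<le> 1" using d_ge by simp
    then have "1 / (2 * real d) \<le> rho" using rho_gt_1 by linarith
    then show ?thesis using True dl_Suc_less[OF True] mult_right_mono[of "1 / (2 * real d)" rho "dl k"] dl_pos[of k] by simp
  next
    case False
    then show ?thesis by (simp add: dl_Suc_ge)
  qed
  also have "\<dots> \<le> rho * rho ^ k"
    using Suc rho_gt_1 by (intro mult_left_mono) auto
  finally show ?case by simp
qed

lemma KW_ge_1: "1 \<le> KW"
proof -
  have "1 \<le> rho / (rho - 1)" using rho_gt_1 by (simp add: field_simps)
  then show ?thesis by (simp add: KW_def)
qed

lemma rate_pos: "0 < rate" and rate_le: "rate \<le> eta / 4"
  using eta_pos KW_ge_1 by (auto simp: rate_def)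

lemma shrink_pos: "0 < shrink"
  using shrink_bounds[OF rate_pos rate_le] by (auto simp: shrink_def)

lemma W_Suc: "W (Suc h) = W h + dl (Suc h)"
  by (simp add: W_def)

lemma mono_W: "mono W"
  by (intro incseq_SucI) (simp add: W_Suc less_imp_le[OF dl_pos])

lemma W_ge_1: "1 \<le> W h"
proof -
  have "W 0 \<le> W h" using mono_W by (rule monoD) simp
  then show ?thesis by (simp add: W_def dl_def)
qed

lemma W_nonneg: "0 \<le> W h"
  using W_ge_1[of h] by linarith

lemma W_le_KW_dl: "W h \<le> KW * dl h"
proof (induction h)
  case 0
  then show ?case using KW_ge_1 by (simp add: W_def dl_def)
next
  case (Suc h)
  show ?case
  proof (cases "h < h0")
    case True
    have D: "1 \<le> 2 * real d" using d_ge by simp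
    have "W (Suc h) \<le> (\<Sum>k\<le>Suc h. 1)"
      unfolding W_def using True D by (intro sum_mono) (auto simp: dl_def power_le_one)
    also have "\<dots> \<le> real h0 + 1" using True by simp
    also have "\<dots> = (real h0 + 1) * (2 * real d) ^ h0 * (1 / (2 * real d)) ^ h0"
      using D by (simp add: power_one_over)
    also have "\<dots> \<le> KW * (1 / (2 * real d)) ^ h0"
      by (intro mult_right_mono) (auto simp: KW_def)
    also have "\<dots> \<le> KW * (1 / (2 * real d)) ^ Suc h"
      using KW_ge_1 D True by (intro mult_left_mono power_decreasing) auto
    finally show ?thesis using True by (simp add: dl_def)
  next
    case False
    then have dl: "dl (Suc h) = rho * dl h" by (simp add: dl_Suc_ge)
    have "rho \<le> KW * (rho - 1)"
    proof -
      have "rho / (rho - 1) \<le> KW" by (simp add: KW_def)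
      then show ?thesis using rho_gt_1 by (simp add: pos_divide_le_eq)
    qed
    then have *: "KW + rho \<le> KW * rho" by (simp add: algebra_simps)
    have "W (Suc h) \<le> KW * dl h + rho * dl h" using Suc by (simp add: W_Suc dl)
    also have "\<dots> \<le> KW * rho * dl h"
      using mult_right_mono[OF * less_imp_le[OF dl_pos[of h]]] by (simp add: algebra_simps)
    finally show ?thesis by (simp add: dl mult_ac)
  qed
qed

lemma W_le_rho: "W h \<le> KW * rho ^ h"
  using W_le_KW_dl[of h] mult_left_mono[OF dl_le_rho[of h], of KW] KW_ge_1 by linarith

lemma avg_moved_W_le:
  assumes x: "length x = n" "x \<notin> bad" and j: "j < n"
  shows "avg (moved W x j) \<le> shrink * W (x ! j)"
proof -
  define h where "h = x ! j"
  define C where "C = real (card {js \<in> tuples n d. shortest x js = j}) / real n ^ d"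
  have n: "0 < real n" using n_pos by simp
  have D: "0 < real d" using d_ge by simp
  have pow: "real n ^ d = real n * real n ^ (d - 1)" "real n ^ (d - 1) = real n * real n ^ (d - 2)"
  proof -
    obtain e where "d = Suc (Suc e)" using d_ge by (metis add_2_eq_Suc le_Suc_ex)
    then show "real n ^ d = real n * real n ^ (d - 1)" "real n ^ (d - 1) = real n * real n ^ (d - 2)"
      by simp_all
  qed
  have "lam * C * dl (Suc h) \<le> dl h / (2 * real n)"
  proof (cases "h < h0")
    case True
    have "real (card {js \<in> tuples n d. shortest x js = j}) \<le> real (d * n ^ (d - 1))"
      using card_pick_le[OF j] of_nat_le_iff by blast
    then have "C \<le> real d * real n ^ (d - 1) / real n ^ d"
      unfolding C_def by (intro divide_right_mono) auto
    also have "\<dots> = real d / real n" using n by (simp add: pow)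
    finally have "C * dl (Suc h) \<le> real d / real n * dl (Suc h)"
      using dl_pos[of "Suc h"] by (intro mult_right_mono) auto
    also have "\<dots> = dl h / (2 * real n)"
      using True D by (simp add: dl_Suc_less)
    finally have *: "C * dl (Suc h) \<le> dl h / (2 * real n)" .
    have "0 \<le> C * dl (Suc h)"
      unfolding C_def using less_imp_le[OF dl_pos] by (intro mult_nonneg_nonneg) auto
    then have "lam * (C * dl (Suc h)) \<le> 1 * (C * dl (Suc h))"
      using lam_less by (intro mult_right_mono) auto
    with * show ?thesis by (simp add: mult.assoc)
  next
    case False
    have "card {k. k < n \<and> x ! j \<le> x ! k} \<le> card {k. k < n \<and> h0 \<le> x ! k}"
      using False by (intro card_mono) (auto simp: h_def)
    then have A: "real (card {k. k < n \<and> x ! j \<le> x ! k}) \<le> real n / (2 * real d)"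
      using x by (auto simp: bad_def)
    have "real (card {js \<in> tuples n d. shortest x js = j})
        \<le> real (d * (card {k. k < n \<and> x ! j \<le> x ! k} * n ^ (d - 2)))"
      using card_pick_le_longer[OF j] of_nat_le_iff by blast
    also have "\<dots> = real d * (real (card {k. k < n \<and> x ! j \<le> x ! k}) * real n ^ (d - 2))"
      by simp
    also have "\<dots> \<le> real d * (real n / (2 * real d) * real n ^ (d - 2))"
      using A by (intro mult_left_mono mult_right_mono) auto
    also have "\<dots> = real n ^ (d - 1) / 2" unfolding pow(2) using D by simp
    finally have "C \<le> real n ^ (d - 1) / 2 / real n ^ d"
      unfolding C_def by (intro divide_right_mono) auto
    also have "\<dots> = 1 / (2 * real n)" using n by (simp add: pow(1))
    finally have "C * (lam * dl (Suc h)) \<le> 1 / (2 * real n) * (lam * dl (Suc h))"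
      using dl_pos[of "Suc h"] lam_pos by (intro mult_right_mono) auto
    also have "lam * dl (Suc h) = (lam * rho) * dl h"
      using False by (simp add: dl_Suc_ge)
    also have "1 / (2 * real n) * (lam * rho * dl h) \<le> 1 / (2 * real n) * (1 * dl h)"
      using lam_rho_less_1 dl_pos[of h] by (intro mult_left_mono mult_right_mono) auto
    finally show ?thesis using False by (simp add: dl_Suc_ge mult_ac)
  qed
  then have 1: "1 / (1 + lam) * (lam * C * dl (Suc h)) \<le> 1 / (1 + lam) * (dl h / (2 * real n))"
    using lam_pos by (intro mult_left_mono) auto
  have last: "(if x ! j = 0 then W 0 else W (x ! j) - W (x ! j - 1)) = dl h"
    by (cases "x ! j") (auto simp: h_def W_def)
  have "avg (moved W x j)
      = W h + 1 / (1 + lam) * (lam * C * dl (Suc h)) - 1 / (1 + lam) * (dl h / real n)"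
    unfolding avg_moved[OF j] last by (simp add: C_def[symmetric] h_def[symmetric] W_Suc)
  also have "\<dots> \<le> W h + 1 / (1 + lam) * (dl h / (2 * real n)) - 1 / (1 + lam) * (dl h / real n)"
    using 1 by linarith
  also have "\<dots> = W h - 1 / (1 + lam) * (dl h / (2 * real n))"
  proof -
    have "W h + a * e - a * (2 * e) = W h - a * e" for a e by (simp add: algebra_simps)
    from this[of "1 / (1 + lam)" "dl h / (2 * real n)"] show ?thesis by simp
  qed
  \<comment> \<open>The half kept above and 1 / (1 + lam) >= 1 / 2 make up the 1 / 4 in
    \<open>rate\<close>.\<close>
  also have "\<dots> \<le> W h - 1 / 2 * (dl h / (2 * real n))"
    using lam_pos lam_less dl_pos[of h] n
    by (intro diff_left_mono mult_right_mono) (auto simp: field_simps)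
  also have "\<dots> \<le> W h - rate / real n * W h"
  proof -
    have "rate * W h \<le> 1 / (4 * KW) * (KW * dl h)"
      using W_le_KW_dl[of h] KW_ge_1 W_ge_1[of h] by (intro mult_mono) (auto simp: rate_def)
    also have "\<dots> = dl h / 4" using KW_ge_1 by simp
    finally have "rate * W h / real n \<le> dl h / 4 / real n"
      using n by (intro divide_right_mono) auto
    then show ?thesis by simp
  qed
  also have "\<dots> = shrink * W (x ! j)"
    by (simp add: shrink_def h_def algebra_simps)
  finally show ?thesis .
qed

text \<open>The expected number of visits to \<open>bad\<close> before time \<open>i\<close>.\<close>

primrec visits :: "nat \<Rightarrow> nat list \<Rightarrow> real" where
  "visits 0 x = 0"
| "visits (Suc i) x = indicator bad x + trans (visits i) x"

lemma visits_nonneg: "0 \<le> visits i x"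
  by (induction i arbitrary: x) (auto intro!: add_nonneg_nonneg trans_nonneg)

lemma trans_mono: "(\<And>y. length y = length x \<Longrightarrow> g y \<le> g' y) \<Longrightarrow> trans g x \<le> trans g' x"
  unfolding trans_def by (intro avg_mono) simp

lemma visits_Suc_ge: "visits i x \<le> visits (Suc i) x"
proof (induction i arbitrary: x)
  case 0
  show ?case using visits_nonneg[of "Suc 0" x] by simp
next
  case (Suc i)
  have "trans (visits i) x \<le> trans (visits (Suc i)) x"
    by (rule trans_mono) (rule Suc)
  then show ?case by simp
qed

lemma visits_mono: "i \<le> k \<Longrightarrow> visits i x \<le> visits k x"
  using visits_Suc_ge by (rule lift_Suc_mono_le)

lemma visits_le: "visits i x \<le> real i"
proof (induction i arbitrary: x)
  case (Suc i)
  have "trans (visits i) x \<le> trans (\<lambda>_. real i) x"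
    by (rule trans_mono) (rule Suc)
  moreover have "indicator bad x \<le> (1 :: real)" by (simp add: indicator_def)
  ultimately show ?case unfolding visits.simps trans_const of_nat_Suc by linarith
qed simp

lemma bad_incr: "length x = n \<Longrightarrow> j < n \<Longrightarrow> x \<in> bad \<Longrightarrow> incr x j \<in> bad"
proof -
  assume x: "length x = n" "j < n" "x \<in> bad"
  have "card {k. k < n \<and> h0 \<le> x ! k} \<le> card {k. k < n \<and> h0 \<le> incr x j ! k}"
    using x by (intro card_mono) (auto simp: nth_incr)
  then show ?thesis using x by (auto simp: bad_def)
qed

text \<open>\<open>bad\<close> is closed under adding a customer and the coupling preserves the
  order, so every visit of the smaller copy is also one of the larger copy.\<close>

lemma visits_incr:
  assumes "length x = n" "j < n"
  shows "visits i x \<le> visits i (incr x j)"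
  using assms
proof (induction i arbitrary: x j)
  case (Suc i)
  have "trans (visits i) x \<le> trans (visits i) (incr x j)"
    unfolding trans_def
  proof (rule avg_mono)
    fix \<omega> assume "\<omega> \<in> events"
    with Suc.prems show "visits i (step x \<omega>) \<le> visits i (step (incr x j) \<omega>)"
    proof (cases rule: coupled_step)
      case (adjacent m)
      then show ?thesis using Suc.IH[of "step x \<omega>" m] Suc.prems by simp
    qed simp
  qed
  moreover have "indicator bad x \<le> (indicator bad (incr x j) :: real)"
    using bad_incr[OF Suc.prems] by (auto simp: indicator_def)
  ultimately show ?case by simp
qed simp

text \<open>The Lipschitz condition for neighbouring states, in the form that the coupling carries
  from g to \<open>trans g\<close>.\<close>

definition adjacent_lipschitz :: "(nat list \<Rightarrow> real) \<Rightarrow> bool" where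
  "adjacent_lipschitz g \<longleftrightarrow> (\<forall>x j. length x = n \<longrightarrow> j < n \<longrightarrow> \<bar>g (incr x j) - g x\<bar> \<le> 1)"

lemma adjacent_lipschitzD:
  "adjacent_lipschitz g \<Longrightarrow> length x = n \<Longrightarrow> j < n \<Longrightarrow> \<bar>g (incr x j) - g x\<bar> \<le> 1"
  by (simp add: adjacent_lipschitz_def)

lemma adjacent_lipschitz_trans:
  assumes "adjacent_lipschitz g"
  shows "adjacent_lipschitz (trans g)"
  unfolding adjacent_lipschitz_def
proof (intro allI impI)
  fix x :: "nat list" and j assume x: "length x = n" "j < n"
  have "\<bar>trans g (incr x j) - trans g x\<bar> \<le> avg (\<lambda>\<omega>. \<bar>g (step (incr x j) \<omega>) - g (step x \<omega>)\<bar>)"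
    unfolding trans_def avg_diff[symmetric] by (rule abs_avg_le)
  also have "\<dots> \<le> avg (\<lambda>\<omega>. 1)"
  proof (rule avg_mono)
    fix \<omega> assume "\<omega> \<in> events"
    with x show "\<bar>g (step (incr x j) \<omega>) - g (step x \<omega>)\<bar> \<le> 1"
    proof (cases rule: coupled_step)
      case (adjacent m)
      then show ?thesis using adjacent_lipschitzD[OF assms, of "step x \<omega>" m] x by simp
    qed simp
  qed
  finally show "\<bar>trans g (incr x j) - trans g x\<bar> \<le> 1" by simp
qed

lemma adjacent_lipschitz_iterate:
  "adjacent_lipschitz f \<Longrightarrow> adjacent_lipschitz ((trans ^^ i) f)"
  by (induction i) (auto intro: adjacent_lipschitz_trans)

text \<open>In a \<open>bad\<close> state the contraction of \<open>W\<close> may fail; there the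
  trivial bound 1 is charged to the current visit. Elsewhere one coupled step advances both
  summands.\<close>

lemma iterate_incr_diff_le:
  assumes f: "adjacent_lipschitz f" and "length x = n" "j < n"
  shows "\<bar>(trans ^^ i) f (incr x j) - (trans ^^ i) f x\<bar> \<le> shrink ^ i * W (x ! j) + visits i x"
  using assms(2,3)
proof (induction i arbitrary: x j)
  case 0
  show ?case
    using adjacent_lipschitzD[OF f 0] W_ge_1[of "x ! j"] by simp
next
  case (Suc i)
  note x = Suc.prems
  show ?case
  proof (cases "x \<in> bad")
    case True
    have "\<bar>(trans ^^ Suc i) f (incr x j) - (trans ^^ Suc i) f x\<bar> \<le> 1"
      using adjacent_lipschitzD[OF adjacent_lipschitz_iterate[OF f] x] .
    also have "1 \<le> visits (Suc i) x"
      using True trans_nonneg[of "visits i" x] visits_nonneg by simp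
    also have "\<dots> \<le> shrink ^ Suc i * W (x ! j) + visits (Suc i) x"
      using shrink_pos W_ge_1[of "x ! j"] by simp
    finally show ?thesis .
  next
    case False
    have "\<bar>trans ((trans ^^ i) f) (incr x j) - trans ((trans ^^ i) f) x\<bar>
        \<le> shrink ^ i * avg (moved W x j) + trans (visits i) x"
      using Suc.IH shrink_pos visits_nonneg mono_W W_ge_1 x
      by (intro trans_incr_diff_le) (auto simp: W_nonneg)
    also have "\<dots> \<le> shrink ^ i * (shrink * W (x ! j)) + trans (visits i) x"
      using avg_moved_W_le[OF x(1) False x(2)] shrink_pos by (intro add_right_mono mult_left_mono) auto
    also have "\<dots> = shrink ^ Suc i * W (x ! j) + visits (Suc i) x"
      using False by simp
    finally show ?thesis by simp
  qed
qed

end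

section \<open>Stationary probability of visits to \<open>bad\<close>\<close>

context stationary_supermarket
begin

lemma prob_bad_le: "measure_pmf.prob p bad \<le> exp (- real n)"
proof -
  have "measure_pmf.prob p bad = measure_pmf.prob p (bad \<inter> set_pmf p)"
    by (simp add: measure_Int_set_pmf)
  also have "\<dots> \<le> measure_pmf.prob p {x. real (total x) > CS * real n}"
  proof (rule measure_pmf.finite_measure_mono)
    show "bad \<inter> set_pmf p \<subseteq> {x. real (total x) > CS * real n}"
    proof
      fix x assume x: "x \<in> bad \<inter> set_pmf p"
      then have len: "length x = n" by (simp add: length_of_set_pmf)
      define A where "A = {k. k < n \<and> h0 \<le> x ! k}"
      have h0: "2 * real d * CS \<le> real h0" unfolding h0_def by linarith
      have h0_pos: "0 < real h0" 
      proof -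
        have "0 < 2 * real d * CS" using CS_pos d_ge by simp
        with h0 show ?thesis by linarith
      qed
      have "CS * real n = 2 * real d * CS * (real n / (2 * real d))"
        using d_ge by simp
      also have "\<dots> \<le> real h0 * (real n / (2 * real d))"
        using h0 by (intro mult_right_mono) auto
      also have "\<dots> < real h0 * real (card A)"
        using x h0_pos by (intro mult_strict_left_mono) (auto simp: bad_def A_def)
      also have "\<dots> = real (\<Sum>k\<in>A. h0)" by simp
      also have "\<dots> \<le> real (\<Sum>k<n. x ! k)"
      proof -
        have "(\<Sum>k\<in>A. h0) \<le> (\<Sum>k\<in>A. x ! k)" by (intro sum_mono) (auto simp: A_def)
        also have "\<dots> \<le> (\<Sum>k<n. x ! k)" by (intro sum_mono2) (auto simp: A_def)
        finally show ?thesis using of_nat_le_iff by blast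
      qed
      finally show "x \<in> {x. real (total x) > CS * real n}" by (simp add: total_def len)
    qed
  qed simp
  finally show ?thesis using prob_total_le by linarith
qed

lemma integrable_visits: "integrable p (visits i)"
  by (intro measure_pmf.integrable_const_bound[where B = "real i"]) (simp_all add: visits_nonneg visits_le)

text \<open>Under stationarity each of the i steps contributes the same probability.\<close>

lemma expectation_visits: "measure_pmf.expectation p (visits i) = real i * measure_pmf.prob p bad"
proof (induction i)
  case (Suc i)
  have "measure_pmf.expectation p (visits (Suc i))
      = measure_pmf.expectation p (\<lambda>x. indicator bad x + trans (visits i) x)"
    by (intro Bochner_Integration.integral_cong) simp_all
  also have "\<dots> = measure_pmf.prob p bad + measure_pmf.expectation p (visits i)"
    by (subst Bochner_Integration.integral_add)
      (auto simp: integrable_indicator_pmf integrable_trans integrable_visits expectation_trans)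
  finally show ?case unfolding Suc.IH by (simp only: of_nat_Suc distrib_right mult_1)
qed simp

lemma prob_visits_le:
  assumes "0 < \<beta>"
  shows "measure_pmf.prob p {x. visits i x > \<beta>} \<le> real i * exp (- real n) / \<beta>"
proof -
  have "measure_pmf.prob p {x. visits i x > \<beta>}
      \<le> measure_pmf.prob p {x \<in> space p. \<beta> \<le> visits i x}"
    by (intro measure_pmf.finite_measure_mono) auto
  also have "\<dots> \<le> measure_pmf.expectation p (visits i) / \<beta>"
    using assms visits_nonneg
    by (intro integral_Markov_inequality_measure[where A = "{}"] integrable_visits) auto
  also have "\<dots> \<le> real i * exp (- real n) / \<beta>"
    unfolding expectation_visits using prob_bad_le assms
    by (intro divide_right_mono mult_left_mono) auto
  finally show ?thesis .
qed

end

section \<open>Concentration under a stationary distribution\<close>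

lemma exp_le_one_plus_square:
  fixes z :: real
  assumes "\<bar>z\<bar> \<le> 1"
  shows "exp z \<le> 1 + z + z\<^sup>2"
proof (cases "0 \<le> z")
  case True
  then show ?thesis using assms exp_bound[of z] by simp
next
  case False
  define a where "a = - z"
  have a: "0 < a" using False by (simp add: a_def)
  have "exp z = 1 / exp a" by (simp add: a_def exp_minus field_simps)
  also have "\<dots> \<le> 1 / (1 + a)"
    using a exp_ge_add_one_self[of a] by (intro divide_left_mono mult_pos_pos) auto
  also have "\<dots> \<le> 1 - a + a\<^sup>2"
  proof -
    have "1 \<le> (1 - a + a\<^sup>2) * (1 + a)"
      using a by (simp add: algebra_simps power2_eq_square)
    then show ?thesis using a by (simp add: pos_divide_le_eq)
  qed
  finally show ?thesis by (simp add: a_def)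
qed

text \<open>Turns a discrepancy truncated at 1 into a multiple of \<open>sat\<close>.\<close>

lemma min_one_le_ratio:
  fixes z K :: real
  assumes "0 \<le> z" "1 \<le> K"
  shows "min 1 (K * z) \<le> 2 * K * (z / (1 + z))"
proof (cases "1 \<le> z")
  case True
  then have "1 / 2 \<le> z / (1 + z)" by (simp add: field_simps)
  then have "2 * 1 * (1 / 2) \<le> 2 * K * (z / (1 + z))"
    using assms by (intro mult_mono) auto
  then show ?thesis by simp
next
  case False
  then have "z / 2 \<le> z / (1 + z)"
    using assms by (intro divide_left_mono) auto
  then have "2 * K * (z / 2) \<le> 2 * K * (z / (1 + z))"
    using assms by (intro mult_left_mono) auto
  then show ?thesis by simp
qed

text \<open>A linear bound for the square is enough, and it is what matches \<open>sat\<close> to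
  first order.\<close>

lemma square_le_min_one:
  fixes a q :: real
  assumes "\<bar>a\<bar> \<le> 1" "\<bar>a\<bar> \<le> q"
  shows "a\<^sup>2 \<le> min 1 q"
proof -
  have "a\<^sup>2 = \<bar>a\<bar> * \<bar>a\<bar>" by (simp add: power2_eq_square)
  also have "\<dots> \<le> 1 * \<bar>a\<bar>" using assms by (intro mult_right_mono) auto
  finally show ?thesis using assms by simp
qed

section \<open>Second and exponential moments of one step\<close>

context supermarket
begin

text \<open>Cauchy-Schwarz by way of AM-GM, with the weight k that balances the two bounds. It
  separates the fluctuation of the iterate from that of \<open>Psi\<close>, at the price of doubling
  both exponents.\<close>

lemma avg_mult_le_exp:
  assumes "avg (\<lambda>\<omega>. (X \<omega>)\<^sup>2) \<le> exp a" "avg (\<lambda>\<omega>. (Y \<omega>)\<^sup>2) \<le> exp b"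
  shows "avg (\<lambda>\<omega>. X \<omega> * Y \<omega>) \<le> exp ((a + b) / 2)"
proof -
  define k where "k = exp ((b - a) / 2)"
  have k: "0 < k" by (simp add: k_def)
  have "X \<omega> * Y \<omega> \<le> k / 2 * (X \<omega>)\<^sup>2 + 1 / (2 * k) * (Y \<omega>)\<^sup>2" for \<omega>
  proof -
    have "0 \<le> (k * X \<omega> - Y \<omega>)\<^sup>2 / (2 * k)" using k by simp
    also have "\<dots> = k / 2 * (X \<omega>)\<^sup>2 + 1 / (2 * k) * (Y \<omega>)\<^sup>2 - X \<omega> * Y \<omega>"
      using k by (simp add: power2_eq_square field_simps)
    finally show ?thesis by simp
  qed
  then have "avg (\<lambda>\<omega>. X \<omega> * Y \<omega>)
      \<le> avg (\<lambda>\<omega>. k / 2 * (X \<omega>)\<^sup>2 + 1 / (2 * k) * (Y \<omega>)\<^sup>2)"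
    by (intro avg_mono)
  also have "\<dots> = k / 2 * avg (\<lambda>\<omega>. (X \<omega>)\<^sup>2) + 1 / (2 * k) * avg (\<lambda>\<omega>. (Y \<omega>)\<^sup>2)"
    unfolding avg_add avg_cmult ..
  also have "\<dots> \<le> k / 2 * exp a + 1 / (2 * k) * exp b"
    using assms k by (intro add_mono mult_left_mono) auto
  also have "k / 2 * exp a = exp ((a + b) / 2) / 2"
    by (simp add: k_def exp_add[symmetric] field_simps)
  also have "1 / (2 * k) * exp b = exp ((a + b) / 2) / 2"
    by (simp add: k_def exp_diff[symmetric] field_simps)
  finally show ?thesis by simp
qed

text \<open>The discrepancy is known at the smaller state; monotonicity of \<open>W\<close> and
  \<open>visits\<close> restates it at x, so increments and decrements share one bound.\<close>

lemma iterate_decr_diff_le: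
  assumes f: "adjacent_lipschitz f" and x: "length x = n" "j < n" "0 < x ! j"
  shows "\<bar>(trans ^^ i) f (decr x j) - (trans ^^ i) f x\<bar> \<le> shrink ^ i * W (x ! j) + visits i x"
    and "\<bar>(trans ^^ i) f (decr x j) - (trans ^^ i) f x\<bar> \<le> 1"
proof -
  define y where "y = decr x j"
  have y: "length y = n" "incr y j = x" "y ! j \<le> x ! j"
    using x by (auto simp: y_def incr_decr nth_decr)
  have "\<bar>(trans ^^ i) f x - (trans ^^ i) f y\<bar> \<le> shrink ^ i * W (y ! j) + visits i y"
    using iterate_incr_diff_le[OF f y(1) x(2), of i] y(2) by simp
  also have "\<dots> \<le> shrink ^ i * W (x ! j) + visits i x"
    using monoD[OF mono_W y(3)] visits_incr[OF y(1) x(2), of i] shrink_pos y(2)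
    by (intro add_mono mult_left_mono) auto
  finally show "\<bar>(trans ^^ i) f (decr x j) - (trans ^^ i) f x\<bar> \<le> shrink ^ i * W (x ! j) + visits i x"
    by (simp add: y_def abs_minus_commute)
  show "\<bar>(trans ^^ i) f (decr x j) - (trans ^^ i) f x\<bar> \<le> 1"
    using adjacent_lipschitzD[OF adjacent_lipschitz_iterate[OF f] y(1) x(2), of i] y(2)
    by (simp add: y_def abs_minus_commute)
qed

lemma sum_shortest_le:
  assumes m: "\<And>j. 0 \<le> m j"
  shows "(\<Sum>js\<in>tuples n d. m (shortest x js)) \<le> real d * real n ^ (d - 1) * (\<Sum>j<n. m j)"
proof -
  have "(\<Sum>js\<in>tuples n d. m (shortest x js))
      = (\<Sum>j<n. \<Sum>js\<in>{js \<in> tuples n d. shortest x js = j}. m (shortest x js))"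
    by (intro sum.group[symmetric] finite_tuples) (auto simp: shortest_less)
  also have "\<dots> = (\<Sum>j<n. real (card {js \<in> tuples n d. shortest x js = j}) * m j)"
    by (intro sum.cong) auto
  also have "\<dots> \<le> (\<Sum>j<n. real (d * n ^ (d - 1)) * m j)"
    using card_pick_le m by (intro sum_mono mult_right_mono of_nat_mono) auto
  finally show ?thesis by (simp add: sum_distrib_left)
qed

text \<open>A given queue is picked with probability at most d / n by an arrival and 1 / n by a
  departure, so the second moment is bounded by a mean over the queues, not a maximum. Truncated at
  1, the summands become \<open>sat\<close> at t = shrink ^ i, the parameter at which
  \<open>Psi\<close> is evaluated.\<close>

lemma avg_square_diff_le:
  assumes f: "adjacent_lipschitz f" and x: "length x = n"
  shows "avg (\<lambda>\<omega>. ((trans ^^ i) f (step x \<omega>) - (trans ^^ i) f x)\<^sup>2)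
    \<le> 2 * KW * (real d + 1) * mean_sat (shrink ^ i) x + (real d + 1) * visits i x"
proof -
  define g where "g = (trans ^^ i) f"
  define m where "m j = min 1 (shrink ^ i * W (x ! j) + visits i x)" for j
  define S where "S = (\<Sum>j<n. m j) / real n"
  have n: "0 < real n" using n_pos by simp
  have m_nn: "0 \<le> m j" for j
    using shrink_pos W_nonneg visits_nonneg by (simp add: m_def)
  have S_nn: "0 \<le> S" unfolding S_def using m_nn by (simp add: sum_nonneg)
  have inc: "(g (incr x j) - g x)\<^sup>2 \<le> m j" if "j < n" for j
    unfolding m_def g_def using iterate_incr_diff_le[OF f x that]
      adjacent_lipschitzD[OF adjacent_lipschitz_iterate[OF f] x that]
    by (intro square_le_min_one) auto
  have dec: "(g (decr x j) - g x)\<^sup>2 \<le> m j" if "j < n" for j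
  proof (cases "x ! j = 0")
    case True
    then show ?thesis using m_nn by (simp add: decr_eq_self)
  next
    case False
    then show ?thesis
      unfolding m_def g_def using iterate_decr_diff_le[OF f x that, of i]
      by (intro square_le_min_one) auto
  qed
  have "(\<Sum>js\<in>tuples n d. (g (step x (Inl js)) - g x)\<^sup>2) \<le> (\<Sum>js\<in>tuples n d. m (shortest x js))"
    using inc shortest_less by (intro sum_mono) auto
  also have "\<dots> \<le> real d * real n ^ (d - 1) * (\<Sum>j<n. m j)"
    using m_nn by (rule sum_shortest_le)
  finally have "(\<Sum>js\<in>tuples n d. (g (step x (Inl js)) - g x)\<^sup>2) / real n ^ d
      \<le> real d * real n ^ (d - 1) * (\<Sum>j<n. m j) / real n ^ d"
    by (intro divide_right_mono) auto
  also have "\<dots> = real d * S"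
  proof -
    obtain e where "d = Suc e" using d_ge by (cases d) auto
    then show ?thesis using n by (simp add: S_def)
  qed
  finally have arr: "(\<Sum>js\<in>tuples n d. (g (step x (Inl js)) - g x)\<^sup>2) / real n ^ d \<le> real d * S" .
  have "(\<Sum>j<n. (g (step x (Inr j)) - g x)\<^sup>2) \<le> (\<Sum>j<n. m j)"
    using dec by (intro sum_mono) auto
  then have dep: "(\<Sum>j<n. (g (step x (Inr j)) - g x)\<^sup>2) / real n \<le> S"
    unfolding S_def by (intro divide_right_mono) auto
  have "avg (\<lambda>\<omega>. (g (step x \<omega>) - g x)\<^sup>2) \<le> lam / (1 + lam) * (real d * S) + 1 / (1 + lam) * S"
    unfolding avg_split using arr dep lam_pos by (intro add_mono mult_left_mono) auto
  also have "\<dots> \<le> 1 * (real d * S) + 1 * S"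
    using lam_pos S_nn by (intro add_mono mult_right_mono) auto
  also have "\<dots> = (real d + 1) * S" by (simp add: algebra_simps)
  finally have main: "avg (\<lambda>\<omega>. (g (step x \<omega>) - g x)\<^sup>2) \<le> (real d + 1) * S" .
  have "S \<le> (\<Sum>j<n. 2 * KW * sat (shrink ^ i) (x ! j) + visits i x) / real n"
    unfolding S_def
  proof (intro divide_right_mono sum_mono)
    fix j
    have "shrink ^ i * W (x ! j) \<le> shrink ^ i * (KW * rho ^ (x ! j))"
      using W_le_rho shrink_pos by (intro mult_left_mono) auto
    then have "m j \<le> min 1 (KW * (shrink ^ i * rho ^ (x ! j))) + visits i x"
      using visits_nonneg[of i x] by (simp add: m_def min_def mult_ac)
    also have "\<dots> \<le> 2 * KW * sat (shrink ^ i) (x ! j) + visits i x"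
      unfolding sat_def using shrink_pos rho_gt_1 KW_ge_1
      by (intro add_right_mono min_one_le_ratio) auto
    finally show "m j \<le> 2 * KW * sat (shrink ^ i) (x ! j) + visits i x" .
  qed simp
  also have "\<dots> = 2 * KW * mean_sat (shrink ^ i) x + visits i x"
    using n by (simp add: sum.distrib sum_distrib_left[symmetric] mean_sat_def add_divide_distrib)
  finally have "(real d + 1) * S \<le> (real d + 1) * (2 * KW * mean_sat (shrink ^ i) x + visits i x)"
    by (intro mult_left_mono) auto
  also have "\<dots> = 2 * KW * (real d + 1) * mean_sat (shrink ^ i) x + (real d + 1) * visits i x"
    by (simp add: algebra_simps)
  finally show ?thesis using main unfolding g_def by linarith
qed

text \<open>The increment is centred at its mean, but its second moment is taken around the current
  value, where the bounds between neighbours apply; the linear terms cancel.\<close>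

lemma avg_exp_iterate_le:
  assumes f: "adjacent_lipschitz f" and x: "length x = n" and \<tau>: "\<bar>\<tau>\<bar> \<le> 1"
  shows "avg (\<lambda>\<omega>. exp (\<tau> * ((trans ^^ i) f (step x \<omega>) - (trans ^^ Suc i) f x)))
    \<le> exp (\<tau>\<^sup>2 * avg (\<lambda>\<omega>. ((trans ^^ i) f (step x \<omega>) - (trans ^^ i) f x)\<^sup>2))"
proof -
  define g where "g = (trans ^^ i) f"
  define Z where "Z \<omega> = g (step x \<omega>) - g x" for \<omega>
  have mean: "trans g x - g x = avg Z"
  proof -
    have "Z = (\<lambda>\<omega>. g (step x \<omega>) - g x)" by (simp add: Z_def fun_eq_iff)
    then show ?thesis by (simp add: trans_def avg_diff)
  qed
  have Z: "\<bar>Z \<omega>\<bar> \<le> 1" if "\<omega> \<in> events" for \<omega>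
    using that
  proof (cases rule: event_cases)
    case (arr js)
    then have "shortest x js < n"
      using arg_min_list_in[of js] by (meson lessThan_iff subsetD)
    then show ?thesis
      using adjacent_lipschitzD[OF adjacent_lipschitz_iterate[OF f] x] arr by (simp add: Z_def g_def)
  next
    case (dep j)
    then show ?thesis
      using iterate_decr_diff_le(2)[OF f x, of j i]
      by (cases "x ! j = 0") (auto simp: Z_def g_def decr_eq_self)
  qed
  have "avg (\<lambda>\<omega>. exp (\<tau> * Z \<omega>)) \<le> avg (\<lambda>\<omega>. 1 + \<tau> * Z \<omega> + \<tau>\<^sup>2 * (Z \<omega>)\<^sup>2)"
  proof (rule avg_mono)
    fix \<omega> assume "\<omega> \<in> events"
    then have "\<bar>\<tau> * Z \<omega>\<bar> \<le> 1 * 1"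
      unfolding abs_mult using \<tau> Z by (intro mult_mono) auto
    then show "exp (\<tau> * Z \<omega>) \<le> 1 + \<tau> * Z \<omega> + \<tau>\<^sup>2 * (Z \<omega>)\<^sup>2"
      using exp_le_one_plus_square[of "\<tau> * Z \<omega>"] by (simp add: power_mult_distrib)
  qed
  also have "\<dots> = 1 + (\<tau> * avg Z + \<tau>\<^sup>2 * avg (\<lambda>\<omega>. (Z \<omega>)\<^sup>2))"
    by (simp add: avg_add avg_cmult)
  also have "\<dots> \<le> exp (\<tau> * avg Z + \<tau>\<^sup>2 * avg (\<lambda>\<omega>. (Z \<omega>)\<^sup>2))"
    by (rule exp_ge_add_one_self)
  finally have *: "avg (\<lambda>\<omega>. exp (\<tau> * Z \<omega>)) \<le> exp (\<tau> * avg Z) * exp (\<tau>\<^sup>2 * avg (\<lambda>\<omega>. (Z \<omega>)\<^sup>2))"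
    by (simp add: exp_add)
  have "avg (\<lambda>\<omega>. exp (\<tau> * (g (step x \<omega>) - trans g x)))
      = exp (- \<tau> * avg Z) * avg (\<lambda>\<omega>. exp (\<tau> * Z \<omega>))"
    unfolding avg_cmult[symmetric] mean[symmetric] exp_add[symmetric] Z_def
    by (simp add: algebra_simps)
  also have "\<dots> \<le> exp (- \<tau> * avg Z) * (exp (\<tau> * avg Z) * exp (\<tau>\<^sup>2 * avg (\<lambda>\<omega>. (Z \<omega>)\<^sup>2)))"
    using * by (intro mult_left_mono) auto
  also have "\<dots> = exp (\<tau>\<^sup>2 * avg (\<lambda>\<omega>. (Z \<omega>)\<^sup>2))"
    by (simp add: exp_add[symmetric])
  finally show ?thesis by (simp add: g_def Z_def)
qed

text \<open>Gives KA * eta / 2 = 4 * KW * (d + 1), the coefficient of mean_sat that the variance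
  leaves after Cauchy-Schwarz.\<close>

definition KA :: real where "KA = 8 * KW * (real d + 1) / eta"

lemma KA_pos: "0 < KA"
  using KW_ge_1 eta_pos by (simp add: KA_def)

text \<open>The negative drift of \<open>Psi\<close> pays for the conditional variance of the next value of the
  iterate.\<close>

lemma avg_exp_step_le:
  assumes f: "adjacent_lipschitz f" and x: "length x = n"
    and \<theta>: "0 \<le> \<theta>" "2 * \<theta> \<le> 1" "2 * KA * \<theta>\<^sup>2 \<le> 1" and v: "visits i x \<le> \<beta>"
  shows "avg (\<lambda>\<omega>. exp (\<theta> * (trans ^^ i) f (step x \<omega>) + KA * \<theta>\<^sup>2 * Psi (shrink ^ i) (step x \<omega>)))
    \<le> exp (\<theta> * (trans ^^ Suc i) f x + KA * \<theta>\<^sup>2 * Psi (shrink ^ Suc i) x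
        + (KA * \<theta>\<^sup>2 * shrink ^ i + 2 * \<theta>\<^sup>2 * (real d + 1) * \<beta>))"
proof -
  define g where "g = (trans ^^ i) f"
  define V where "V = avg (\<lambda>\<omega>. (g (step x \<omega>) - g x)\<^sup>2)"
  define X where "X \<omega> = exp (\<theta> * (g (step x \<omega>) - trans g x))" for \<omega>
  define Y where "Y \<omega> = exp (KA * \<theta>\<^sup>2 * Psi (shrink ^ i) (step x \<omega>))" for \<omega>
  define M where "M = mean_sat (shrink ^ i) x"
  define b where "b = 2 * KA * \<theta>\<^sup>2 * (Psi (shrink ^ Suc i) x - eta / 2 * M + shrink ^ i)"
  \<comment> \<open>The squares double theta and KA * theta^2; this is where the two smallness
    conditions on theta come from.\<close>
  have "(\<lambda>\<omega>. (X \<omega>)\<^sup>2) = (\<lambda>\<omega>. exp ((2 * \<theta>) * (g (step x \<omega>) - trans g x)))"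
    unfolding X_def exp_double[symmetric] by (simp add: mult.assoc)
  then have XX: "avg (\<lambda>\<omega>. (X \<omega>)\<^sup>2) \<le> exp ((2 * \<theta>)\<^sup>2 * V)"
    using avg_exp_iterate_le[OF f x, of "2 * \<theta>" i] \<theta> by (simp add: V_def g_def)
  have "(\<lambda>\<omega>. (Y \<omega>)\<^sup>2) = (\<lambda>\<omega>. exp ((2 * KA * \<theta>\<^sup>2) * Psi (shrink ^ i) (step x \<omega>)))"
    unfolding Y_def exp_double[symmetric] by (simp add: mult.assoc)
  then have YY: "avg (\<lambda>\<omega>. (Y \<omega>)\<^sup>2) \<le> exp b"
    using avg_exp_Psi_le[OF x _ rate_pos rate_le, of "shrink ^ i" "2 * KA * \<theta>\<^sup>2"] \<theta> KA_pos shrink_pos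
    by (simp add: b_def M_def shrink_def[symmetric] mult.commute[of "shrink ^ i" shrink])
  have "avg (\<lambda>\<omega>. exp (\<theta> * g (step x \<omega>) + KA * \<theta>\<^sup>2 * Psi (shrink ^ i) (step x \<omega>)))
      = exp (\<theta> * trans g x) * avg (\<lambda>\<omega>. X \<omega> * Y \<omega>)"
    unfolding avg_cmult[symmetric] X_def Y_def exp_add[symmetric] by (simp add: algebra_simps)
  also have "\<dots> \<le> exp (\<theta> * trans g x) * exp (((2 * \<theta>)\<^sup>2 * V + b) / 2)"
    using avg_mult_le_exp[OF XX YY] by (intro mult_left_mono) auto
  also have "\<dots> = exp (\<theta> * trans g x + (2 * \<theta>\<^sup>2 * V + b / 2))"
    by (simp add: exp_add[symmetric] power2_eq_square field_simps)
  also have "\<dots> \<le> exp (\<theta> * trans g x + (KA * \<theta>\<^sup>2 * Psi (shrink ^ Suc i) x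
        + (KA * \<theta>\<^sup>2 * shrink ^ i + 2 * \<theta>\<^sup>2 * (real d + 1) * \<beta>)))"
  proof -
    have "V \<le> 2 * KW * (real d + 1) * M + (real d + 1) * visits i x"
      unfolding V_def g_def M_def by (rule avg_square_diff_le[OF f x])
    also have "\<dots> \<le> 2 * KW * (real d + 1) * M + (real d + 1) * \<beta>"
      using v by (intro add_left_mono mult_left_mono) auto
    finally have "2 * \<theta>\<^sup>2 * V \<le> 2 * \<theta>\<^sup>2 * (2 * KW * (real d + 1) * M + (real d + 1) * \<beta>)"
      by (intro mult_left_mono) auto
    also have "\<dots> = \<theta>\<^sup>2 * (4 * KW * (real d + 1)) * M + 2 * \<theta>\<^sup>2 * (real d + 1) * \<beta>"
      by (simp add: algebra_simps)
    also have "4 * KW * (real d + 1) = KA * eta / 2"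
      using eta_pos by (simp add: KA_def)
    finally have "2 * \<theta>\<^sup>2 * V \<le> \<theta>\<^sup>2 * (KA * eta / 2) * M + 2 * \<theta>\<^sup>2 * (real d + 1) * \<beta>" .
    moreover have "b / 2 = KA * \<theta>\<^sup>2 * Psi (shrink ^ Suc i) x - \<theta>\<^sup>2 * (KA * eta / 2) * M
        + KA * \<theta>\<^sup>2 * shrink ^ i"
    proof -
      have "b / 2 = KA * \<theta>\<^sup>2 * (Psi (shrink ^ Suc i) x - eta / 2 * M + shrink ^ i)"
        by (simp add: b_def)
      then show ?thesis by (simp add: algebra_simps)
    qed
    ultimately show ?thesis unfolding exp_le_cancel_iff by linarith
  qed
  finally show ?thesis by (simp add: g_def add.assoc)
qed

section \<open>Forgetting the initial state within the horizon\<close>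

lemma iterate_dist_zero:
  assumes f: "adjacent_lipschitz f" and x: "length x = n"
  shows "\<bar>(trans ^^ i) f x - (trans ^^ i) f (replicate n 0)\<bar>
      \<le> real (total x) * (shrink ^ i * W (total x) + visits i x)"
    and "\<bar>(trans ^^ i) f x - (trans ^^ i) f (replicate n 0)\<bar> \<le> real (total x)"
proof -
  have "\<bar>(trans ^^ i) f x - (trans ^^ i) f (replicate n 0)\<bar>
      \<le> real (total x) * (shrink ^ i * W (total x) + visits i x) \<and>
    \<bar>(trans ^^ i) f x - (trans ^^ i) f (replicate n 0)\<bar> \<le> real (total x)"
    using x
  proof (induction "total x" arbitrary: x)
    case 0
    then have "\<forall>j<n. x ! j = 0" by (simp add: total_def)
    then have x: "x = replicate n 0" using 0 by (simp add: list_eq_iff_nth_eq)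
    have "total (replicate n 0) = 0" by (simp add: total_def)
    then show ?case unfolding x by simp
  next
    case (Suc k)
    have "\<exists>j<n. 0 < x ! j"
    proof (rule ccontr)
      assume "\<not> ?thesis"
      then have "total x = 0" using Suc.prems by (simp add: total_def)
      then show False using Suc.hyps(2) by simp
    qed
    then obtain j where j: "j < n" "0 < x ! j" by blast
    define y where "y = decr x j"
    have y: "length y = n" "incr y j = x"
      using Suc.prems j by (auto simp: y_def incr_decr)
    have tot: "total x = total y + 1"
    proof -
      have "total x = (\<Sum>i<n. y ! i + (if i = j then 1 else 0))"
        unfolding total_def Suc.prems y_def using Suc.prems j by (intro sum.cong) (auto simp: nth_decr)
      then show ?thesis using j y by (simp add: sum.distrib total_def)
    qed
    \<comment> \<open>The bound at y is weakened to the one at x, so that every removal of a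
      customer costs the same amount.\<close>
    have v: "visits i y \<le> visits i x"
      using visits_incr[OF y(1) j(1)] y(2) by simp
    have "shrink ^ i * W (total y) + visits i y \<le> shrink ^ i * W (total x) + visits i x"
      using v tot shrink_pos by (intro add_mono mult_left_mono monoD[OF mono_W]) auto
    then have "real k * (shrink ^ i * W (total y) + visits i y)
        \<le> real k * (shrink ^ i * W (total x) + visits i x)"
      by (intro mult_left_mono) auto
    moreover have IH: "\<bar>(trans ^^ i) f y - (trans ^^ i) f (replicate n 0)\<bar>
        \<le> real k * (shrink ^ i * W (total y) + visits i y)"
      "\<bar>(trans ^^ i) f y - (trans ^^ i) f (replicate n 0)\<bar> \<le> real k"
      using Suc.hyps tot y by auto
    moreover have "\<bar>(trans ^^ i) f y - (trans ^^ i) f x\<bar> \<le> shrink ^ i * W (total x) + visits i x"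
    proof -
      have "x ! j \<le> total x"
        unfolding total_def using j Suc.prems by (intro member_le_sum) auto
      then have "shrink ^ i * W (x ! j) \<le> shrink ^ i * W (total x)"
        using shrink_pos by (intro mult_left_mono monoD[OF mono_W]) auto
      then show ?thesis
        using iterate_decr_diff_le(1)[OF f Suc.prems j, of i] by (simp add: y_def)
    qed
    moreover have "\<bar>(trans ^^ i) f y - (trans ^^ i) f x\<bar> \<le> 1"
      using iterate_decr_diff_le(2)[OF f Suc.prems j, of i] by (simp add: y_def)
    moreover have "real (total x) * (shrink ^ i * W (total x) + visits i x)
        = real k * (shrink ^ i * W (total x) + visits i x) + (shrink ^ i * W (total x) + visits i x)"
      unfolding Suc.hyps(2)[symmetric] by (simp add: algebra_simps)
    moreover have "real (total x) = real k + 1" using Suc.hyps(2)[symmetric] by simp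
    ultimately show ?case by - (intro conjI; linarith)
  qed
  then show "\<bar>(trans ^^ i) f x - (trans ^^ i) f (replicate n 0)\<bar>
      \<le> real (total x) * (shrink ^ i * W (total x) + visits i x)"
    and "\<bar>(trans ^^ i) f x - (trans ^^ i) f (replicate n 0)\<bar> \<le> real (total x)"
    by auto
qed

text \<open>Makes rate * KL at least CS * ln rho + 1, so that after KL * n^2 steps the factor exp
  (CS * ln rho * n) of a queue with CS * n customers is beaten by a margin exp (- n).\<close>

definition KL :: nat where "KL = nat \<lceil>(CS * ln rho + 1) / rate\<rceil>"

definition horizon :: nat where "horizon = KL * n\<^sup>2"

text \<open>The threshold 1 / n^2 is matched to the horizon: KL * n^2 steps with errors of that
  order add up to a constant, and so do the errors of up to CS * n customers.\<close>

definition atypical :: "nat list set" where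
  "atypical = {x. visits horizon x > 1 / (real n)\<^sup>2} \<union> {x. real (total x) > CS * real n}"

text \<open>The summands come from typical states, from the expected number of customers beyond CS *
  n, and from states with too many expected visits.\<close>

definition KB :: real where "KB = CS * (KW + 1) + (CS + CS * real KL)"

text \<open>The summands come from the last value of \<open>Psi\<close>, from the geometric sum of
  its sources, and from the visit errors over the horizon.\<close>

definition KC :: real where "KC = KA + KA / rate + 2 * (real d + 1) * real KL"

lemma KB_nonneg: "0 \<le> KB"
  using CS_pos KW_ge_1 by (simp add: KB_def)

lemma KC_pos: "0 < KC"
  using KA_pos rate_pos by (simp add: KC_def add_pos_nonneg)

lemma shrink_horizon: "shrink ^ horizon * rho ^ h \<le> exp (- real n)" if h: "real h \<le> CS * real n"
proof -
  have n: "0 < real n" using n_pos by simp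
  have "(CS * ln rho + 1) / rate \<le> real KL" unfolding KL_def by linarith
  then have KL: "CS * ln rho + 1 \<le> rate * real KL"
    using rate_pos by (simp add: pos_divide_le_eq mult.commute)
  have "shrink ^ horizon \<le> exp (- rate / real n) ^ horizon"
    using exp_ge_add_one_self[of "- rate / real n"] shrink_pos
    by (intro power_mono) (auto simp: shrink_def)
  also have "\<dots> = exp (- (rate * real KL) * real n)"
    using n by (simp add: exp_of_nat_mult[symmetric] horizon_def power2_eq_square)
  also have "\<dots> \<le> exp (- (CS * ln rho + 1) * real n)"
    using mult_right_mono[OF KL, of "real n"] n by (simp add: algebra_simps)
  finally have 1: "shrink ^ horizon \<le> exp (- (CS * ln rho + 1) * real n)" .
  have "rho ^ h = exp (real h * ln rho)"
    using rho_gt_1 by (simp add: exp_of_nat_mult)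
  also have "\<dots> \<le> exp (CS * real n * ln rho)"
    using h rho_gt_1 by simp
  finally have "shrink ^ horizon * rho ^ h
      \<le> exp (- (CS * ln rho + 1) * real n) * exp (CS * real n * ln rho)"
    using 1 rho_gt_1 by (intro mult_mono) auto
  also have "\<dots> = exp (- real n)"
    by (simp add: exp_add[symmetric] algebra_simps)
  finally show ?thesis .
qed

lemma n_mult_exp_le: "real n * exp (- real n) \<le> 1"
proof -
  have "real n \<le> exp (real n)" using exp_ge_add_one_self[of "real n"] by linarith
  then have "real n * exp (- real n) \<le> exp (real n) * exp (- real n)"
    by (intro mult_right_mono) auto
  then show ?thesis by (simp add: exp_add[symmetric])
qed

lemma typical_iterate:
  assumes f: "adjacent_lipschitz f" and x: "length x = n" "x \<notin> atypical"
  shows "\<bar>(trans ^^ horizon) f x - (trans ^^ horizon) f (replicate n 0)\<bar> \<le> CS * (KW + 1)"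
proof -
  have n: "1 \<le> real n" using n_pos by simp
  have v: "visits horizon x \<le> 1 / (real n)\<^sup>2" and t: "real (total x) \<le> CS * real n"
    using x by (auto simp: atypical_def)
  have "shrink ^ horizon * W (total x) \<le> shrink ^ horizon * (KW * rho ^ total x)"
    using W_le_rho shrink_pos by (intro mult_left_mono) auto
  also have "\<dots> = KW * (shrink ^ horizon * rho ^ total x)" by simp
  also have "\<dots> \<le> KW * exp (- real n)"
    using shrink_horizon[OF t] KW_ge_1 by (intro mult_left_mono) auto
  finally have W: "shrink ^ horizon * W (total x) \<le> KW * exp (- real n)" .
  have "\<bar>(trans ^^ horizon) f x - (trans ^^ horizon) f (replicate n 0)\<bar>
      \<le> real (total x) * (shrink ^ horizon * W (total x) + visits horizon x)"
    by (rule iterate_dist_zero[OF f x(1)])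
  also have "\<dots> \<le> CS * real n * (KW * exp (- real n) + 1 / (real n)\<^sup>2)"
  proof (rule mult_mono)
    show "shrink ^ horizon * W (total x) + visits horizon x \<le> KW * exp (- real n) + 1 / (real n)\<^sup>2"
      using W v by (rule add_mono)
    show "0 \<le> shrink ^ horizon * W (total x) + visits horizon x"
      using shrink_pos W_nonneg visits_nonneg by simp
  qed (use t CS_pos in auto)
  also have "\<dots> = CS * (KW * (real n * exp (- real n)) + 1 / real n)"
    using n by (simp add: field_simps power2_eq_square)
  also have "\<dots> \<le> CS * (KW * 1 + 1)"
    using n_mult_exp_le n CS_pos KW_ge_1 by (intro mult_left_mono add_mono) auto
  finally show ?thesis by simp
qed

lemma typical_Psi:
  assumes x: "length x = n" "x \<notin> atypical"
  shows "Psi (shrink ^ horizon) x \<le> 1"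
proof -
  have t: "real (total x) \<le> CS * real n" using x by (auto simp: atypical_def)
  have "Psi (shrink ^ horizon) x \<le> (\<Sum>j<n. exp (- real n))"
    unfolding Psi_def
  proof (rule sum_mono)
    fix j assume j: "j \<in> {..<n}"
    have "x ! j \<le> total x"
      unfolding total_def using j x by (intro member_le_sum) auto
    then have "real (x ! j) \<le> CS * real n" using t by linarith
    then have "shrink ^ horizon * rho ^ (x ! j) \<le> exp (- real n)" by (rule shrink_horizon)
    moreover have "ln (1 + shrink ^ horizon * rho ^ (x ! j)) \<le> shrink ^ horizon * rho ^ (x ! j)"
      using shrink_pos rho_gt_1 by (intro ln_add_one_self_le_self) auto
    ultimately show "ln (1 + shrink ^ horizon * rho ^ (x ! j)) \<le> exp (- real n)" by linarith
  qed
  also have "\<dots> \<le> 1" using n_mult_exp_le by simp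
  finally show ?thesis .
qed

text \<open>The visit condition may fail in each of the \<open>horizon\<close> iterations and once
  more at the end; the last term is the tail of the number of customers.\<close>

definition err :: real where
  "err = (real horizon + 1) * (real horizon * (real n)\<^sup>2 * exp (- real n)) + exp (- real n)"

end

lemma prob_Un_le: "measure_pmf.prob p (A \<union> B) \<le> measure_pmf.prob p A + measure_pmf.prob p B"
  by (rule measure_subadditive) (auto simp: measure_pmf.emeasure_eq_measure)

section \<open>Iteration of the exponential bound for f\<close>

context stationary_supermarket
begin

lemma prob_visits_horizon:
  "measure_pmf.prob p {x. visits horizon x > 1 / (real n)\<^sup>2} \<le> real horizon * (real n)\<^sup>2 * exp (- real n)"
  using prob_visits_le[of "1 / (real n)\<^sup>2" horizon] n_pos by (simp add: mult_ac)

lemma prob_atypical: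
  "measure_pmf.prob p atypical \<le> real horizon * (real n)\<^sup>2 * exp (- real n) + exp (- real n)"
  unfolding atypical_def
  by (rule order_trans[OF prob_Un_le add_mono[OF prob_visits_horizon prob_total_le]])

lemma integrable_adjacent_lipschitz:
  assumes "adjacent_lipschitz f"
  shows "integrable p f"
proof (rule Bochner_Integration.integrable_bound)
  show "integrable p (\<lambda>x. real (total x) + \<bar>f (replicate n 0)\<bar>)"
    using integrable_total by simp
  show "AE x in p. norm (f x) \<le> norm (real (total x) + \<bar>f (replicate n 0)\<bar>)"
  proof (intro AE_pmfI)
    fix x assume "x \<in> set_pmf p"
    then show "norm (f x) \<le> norm (real (total x) + \<bar>f (replicate n 0)\<bar>)"
      using iterate_dist_zero(2)[OF assms length_of_set_pmf, of x 0] by simp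
  qed
qed simp

lemma expectation_iterate:
  assumes "adjacent_lipschitz f"
  shows "measure_pmf.expectation p ((trans ^^ i) f) = measure_pmf.expectation p f"
proof (induction i)
  case (Suc i)
  then show ?case
    using expectation_trans[OF integrable_adjacent_lipschitz[OF adjacent_lipschitz_iterate[OF assms]], of i]
    by simp
qed simp

text \<open>f and its iterates have the same mean, and the last iterate is almost constant on
  typical states. So the unknown mean may be traded for the value at the empty state.\<close>

lemma mean_near_iterate_zero:
  assumes f: "adjacent_lipschitz f" and big: "real n ^ 5 * exp (- real n) \<le> 1"
  shows "\<bar>measure_pmf.expectation p f - (trans ^^ horizon) f (replicate n 0)\<bar> \<le> KB"
proof -
  define g where "g = (trans ^^ horizon) f"
  define V where "V = {x. visits horizon x > 1 / (real n)\<^sup>2}"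
  define S where "S = {x. real (total x) > CS * real n}"
  have n: "0 < real n" using n_pos by simp
  have int_g: "integrable p g"
    unfolding g_def by (intro integrable_adjacent_lipschitz adjacent_lipschitz_iterate f)
  have int1: "integrable p (\<lambda>x. real (total x) * indicator S x)"
    by (intro integrable_real_mult_indicator integrable_total) simp
  have int2: "integrable p (\<lambda>x. CS * real n * indicator V x)"
    by (intro Bochner_Integration.integrable_mult_right integrable_indicator_pmf)
  have "\<bar>measure_pmf.expectation p f - g (replicate n 0)\<bar>
      = \<bar>measure_pmf.expectation p (\<lambda>x. g x - g (replicate n 0))\<bar>"
    using int_g expectation_iterate[OF f, of horizon] by (simp add: g_def)
  also have "\<dots> \<le> measure_pmf.expectation p (\<lambda>x. \<bar>g x - g (replicate n 0)\<bar>)"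
    by (rule integral_abs_bound)
  also have "\<dots> \<le> measure_pmf.expectation p
      (\<lambda>x. CS * (KW + 1) + (real (total x) * indicator S x + CS * real n * indicator V x))"
  proof (rule expectation_mono)
    fix x :: "nat list" assume x: "length x = n"
    show "\<bar>g x - g (replicate n 0)\<bar>
        \<le> CS * (KW + 1) + (real (total x) * indicator S x + CS * real n * indicator V x)"
    proof (cases "x \<in> atypical")
      case True
      have "0 \<le> CS * (KW + 1)" using CS_pos KW_ge_1 by simp
      moreover have "\<bar>g x - g (replicate n 0)\<bar> \<le> real (total x)"
        unfolding g_def by (rule iterate_dist_zero[OF f x])
      \<comment> \<open>An atypical state has more than CS * n customers, or at most that many and
        too many visits.\<close>
      moreover have "real (total x) \<le> real (total x) * indicator S x + CS * real n * indicator V x"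
        using True CS_pos by (auto simp: atypical_def S_def V_def indicator_def)
      ultimately show ?thesis by linarith
    next
      case False
      have "0 \<le> real (total x) * indicator S x + CS * real n * indicator V x"
        using CS_pos by simp
      then show ?thesis
        using typical_iterate[OF f x False] unfolding g_def by linarith
    qed
  qed (use int_g int1 int2 in auto)
  also have "\<dots> = CS * (KW + 1) + (measure_pmf.expectation p (\<lambda>x. real (total x) * indicator S x)
      + CS * real n * measure_pmf.prob p V)"
    using int1 int2 by simp
  also have "\<dots> \<le> CS * (KW + 1) + (CS + CS * real KL)"
  proof -
    have "real n * measure_pmf.prob p V \<le> real n * (real horizon * (real n)\<^sup>2 * exp (- real n))"
      unfolding V_def by (intro mult_left_mono prob_visits_horizon) auto
    also have "\<dots> = real KL * (real n ^ 5 * exp (- real n))"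
      by (simp add: horizon_def power2_eq_square eval_nat_numeral)
    also have "\<dots> \<le> real KL * 1"
      using big by (intro mult_left_mono) auto
    finally have "CS * (real n * measure_pmf.prob p V) \<le> CS * real KL"
      using CS_pos by (intro mult_left_mono) auto
    then show ?thesis
      using expectation_total_tail by (simp add: S_def mult.assoc)
  qed
  finally show ?thesis by (simp add: KB_def g_def)
qed

lemma expectation_min_exp_iterate:
  assumes f: "adjacent_lipschitz f"
    and \<theta>: "0 \<le> \<theta>" "2 * \<theta> \<le> 1" "2 * KA * \<theta>\<^sup>2 \<le> 1" and i: "i \<le> horizon"
  defines "\<epsilon> \<equiv> \<lambda>k. KA * \<theta>\<^sup>2 * shrink ^ k + 2 * \<theta>\<^sup>2 * (real d + 1) * (1 / (real n)\<^sup>2)"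
  shows "measure_pmf.expectation p (\<lambda>x. min (exp (\<theta> * f x + KA * \<theta>\<^sup>2 * Psi 1 x + a)) (exp N))
    \<le> measure_pmf.expectation p (\<lambda>x. min (exp (\<theta> * (trans ^^ i) f x
          + KA * \<theta>\<^sup>2 * Psi (shrink ^ i) x + (a + (\<Sum>k<i. \<epsilon> k)))) (exp N))
      + real i * (exp N * measure_pmf.prob p {x. visits horizon x > 1 / (real n)\<^sup>2})"
  using i
proof (induction i)
  case 0
  then show ?case by simp
next
  case (Suc i)
  define B where "B = {x. visits horizon x > 1 / (real n)\<^sup>2}"
  have "measure_pmf.expectation p (\<lambda>x. min (exp (\<theta> * (trans ^^ i) f x
          + KA * \<theta>\<^sup>2 * Psi (shrink ^ i) x + (a + (\<Sum>k<i. \<epsilon> k)))) (exp N))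
    \<le> measure_pmf.expectation p (\<lambda>x. min (exp (\<theta> * (trans ^^ Suc i) f x
          + KA * \<theta>\<^sup>2 * Psi (shrink ^ Suc i) x + (a + (\<Sum>k<Suc i. \<epsilon> k)))) (exp N))
      + exp N * measure_pmf.prob p B"
  proof (rule expectation_min_trans)
    fix x :: "nat list" assume x: "length x = n" "x \<notin> B"
    define E where "E = a + (\<Sum>k<i. \<epsilon> k)"
    \<comment> \<open>One exceptional set serves all i, because \<open>visits\<close> increases with
      time.\<close>
    have v: "visits i x \<le> 1 / (real n)\<^sup>2"
      using x visits_mono[of i horizon x] Suc.prems by (simp add: B_def)
    have "trans (\<lambda>y. exp (\<theta> * (trans ^^ i) f y + KA * \<theta>\<^sup>2 * Psi (shrink ^ i) y + E)) x
        = exp E * avg (\<lambda>\<omega>. exp (\<theta> * (trans ^^ i) f (step x \<omega>)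
            + KA * \<theta>\<^sup>2 * Psi (shrink ^ i) (step x \<omega>)))"
      unfolding avg_cmult[symmetric] trans_def by (simp add: exp_add mult_ac)
    also have "\<dots> \<le> exp E * exp (\<theta> * (trans ^^ Suc i) f x
        + KA * \<theta>\<^sup>2 * Psi (shrink ^ Suc i) x + \<epsilon> i)"
      unfolding \<epsilon>_def by (intro mult_left_mono avg_exp_step_le f x \<theta> v) auto
    also have "\<dots> = exp (\<theta> * (trans ^^ Suc i) f x
        + KA * \<theta>\<^sup>2 * Psi (shrink ^ Suc i) x + (a + (\<Sum>k<Suc i. \<epsilon> k)))"
      unfolding E_def exp_add[symmetric] by (simp add: add_ac)
    finally show "trans (\<lambda>y. exp (\<theta> * (trans ^^ i) f y + KA * \<theta>\<^sup>2 * Psi (shrink ^ i) y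
          + (a + (\<Sum>k<i. \<epsilon> k)))) x
        \<le> exp (\<theta> * (trans ^^ Suc i) f x
          + KA * \<theta>\<^sup>2 * Psi (shrink ^ Suc i) x + (a + (\<Sum>k<Suc i. \<epsilon> k)))"
      unfolding E_def .
  qed
  moreover have "real (Suc i) * (exp N * measure_pmf.prob p B)
      = real i * (exp N * measure_pmf.prob p B) + exp N * measure_pmf.prob p B"
    by (simp add: algebra_simps)
  ultimately show ?case using Suc unfolding B_def by linarith
qed

lemma upper_tail:
  assumes f: "adjacent_lipschitz f" and big: "real n ^ 5 * exp (- real n) \<le> 1"
    and \<theta>: "0 \<le> \<theta>" "2 * \<theta> \<le> 1" "2 * KA * \<theta>\<^sup>2 \<le> 1"
  shows "measure_pmf.prob p {x. f x - measure_pmf.expectation p f \<ge> 2 * u}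
    \<le> exp (- 2 * \<theta> * u + \<theta> * (2 * KB) + KC * \<theta>\<^sup>2 * real n) + err"
proof -
  define \<mu> where "\<mu> = measure_pmf.expectation p f"
  \<comment> \<open>The cutoff sits exactly at the exponent guaranteed on the event, so Markov's
    inequality loses nothing by it, and division by exp N leaves the exceptional probabilities
    bare.\<close>
  define N where "N = 2 * \<theta> * u"
  define \<epsilon> where "\<epsilon> = (\<lambda>k. KA * \<theta>\<^sup>2 * shrink ^ k + 2 * \<theta>\<^sup>2 * (real d + 1) * (1 / (real n)\<^sup>2))"
  define g where "g = (trans ^^ horizon) f"
  define F where "F x = \<theta> * g x + KA * \<theta>\<^sup>2 * Psi (shrink ^ horizon) x
    + (- \<theta> * \<mu> + (\<Sum>k<horizon. \<epsilon> k))" for x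
  define E where "E = \<theta> * (2 * KB) + KC * \<theta>\<^sup>2 * real n"
  have n: "1 \<le> real n" using n_pos by simp
  have coeff: "0 \<le> KA * \<theta>\<^sup>2" using KA_pos by simp
  have sum_eps: "(\<Sum>k<horizon. \<epsilon> k) \<le> (KA / rate + 2 * (real d + 1) * real KL) * \<theta>\<^sup>2 * real n"
  proof -
    have "(\<Sum>k<horizon. \<epsilon> k) = KA * \<theta>\<^sup>2 * (\<Sum>k<horizon. shrink ^ k)
        + 2 * \<theta>\<^sup>2 * (real d + 1) * (real horizon / (real n)\<^sup>2)"
      unfolding \<epsilon>_def sum.distrib sum_distrib_left by simp
    also have "real horizon / (real n)\<^sup>2 = real KL"
      using n by (simp add: horizon_def)
    also have "KA * \<theta>\<^sup>2 * (\<Sum>k<horizon. shrink ^ k) \<le> KA * \<theta>\<^sup>2 * (real n / rate)"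
      using sum_shrink_le[OF rate_pos rate_le] coeff
      unfolding shrink_def by (intro mult_left_mono) auto
    also have "2 * \<theta>\<^sup>2 * (real d + 1) * real KL \<le> 2 * \<theta>\<^sup>2 * (real d + 1) * real KL * real n"
      using mult_left_mono[OF n, of "2 * \<theta>\<^sup>2 * (real d + 1) * real KL"] by simp
    finally show ?thesis by (simp add: algebra_simps)
  qed
  have typical: "F x \<le> E" if x: "length x = n" "x \<notin> atypical" for x
  proof -
    \<comment> \<open>One \<open>KB\<close> is for the mean; the other covers the distance of g x
      from the value at the empty state, as CS * (KW + 1) is at most \<open>KB\<close>.\<close>
    have "g x - \<mu> \<le> 2 * KB"
    proof -
      have "0 \<le> CS + CS * real KL" using CS_pos by simp
      then show ?thesis
        using abs_le_D1[OF typical_iterate[OF f x]] abs_le_D2[OF mean_near_iterate_zero[OF f big]]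
        unfolding g_def \<mu>_def KB_def mult_2 by linarith
    qed
    then have "\<theta> * (g x - \<mu>) \<le> \<theta> * (2 * KB)" using \<theta> by (intro mult_left_mono)
    moreover have "KA * \<theta>\<^sup>2 * Psi (shrink ^ horizon) x \<le> KA * \<theta>\<^sup>2 * real n"
      using typical_Psi[OF x] n coeff by (intro mult_left_mono) auto
    ultimately show ?thesis
      using sum_eps by (simp add: F_def E_def KC_def algebra_simps)
  qed
  have "exp N * measure_pmf.prob p {x. f x - \<mu> \<ge> 2 * u}
      = measure_pmf.expectation p (\<lambda>x. exp N * indicator {x. f x - \<mu> \<ge> 2 * u} x)"
    by simp
  also have "\<dots> \<le> measure_pmf.expectation p
      (\<lambda>x. min (exp (\<theta> * f x + KA * \<theta>\<^sup>2 * Psi 1 x + - \<theta> * \<mu>)) (exp N))"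
  proof (rule expectation_mono)
    fix x :: "nat list" assume "length x = n"
    show "exp N * indicator {x. f x - \<mu> \<ge> 2 * u} x
        \<le> min (exp (\<theta> * f x + KA * \<theta>\<^sup>2 * Psi 1 x + - \<theta> * \<mu>)) (exp N)"
    proof (cases "f x - \<mu> \<ge> 2 * u")
      case True
      have "\<theta> * (2 * u) \<le> \<theta> * (f x - \<mu>)" using True \<theta> by (intro mult_left_mono)
      moreover have "0 \<le> KA * \<theta>\<^sup>2 * Psi 1 x" using coeff Psi_nonneg by simp
      ultimately show ?thesis using True by (simp add: N_def algebra_simps)
    qed simp
  qed (intro integrable_min_exp Bochner_Integration.integrable_mult_right integrable_indicator_pmf)+
  also have "\<dots> \<le> measure_pmf.expectation p (\<lambda>x. min (exp (F x)) (exp N))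
      + real horizon * (exp N * measure_pmf.prob p {x. visits horizon x > 1 / (real n)\<^sup>2})"
    unfolding F_def g_def \<epsilon>_def by (rule expectation_min_exp_iterate[OF f \<theta> order_refl])
  also have "measure_pmf.expectation p (\<lambda>x. min (exp (F x)) (exp N))
      \<le> measure_pmf.expectation p (\<lambda>x. exp E + exp N * indicator atypical x)"
  proof (rule expectation_mono)
    fix x :: "nat list" assume "length x = n"
    then show "min (exp (F x)) (exp N) \<le> exp E + exp N * indicator atypical x"
      using typical[of x] by (cases "x \<in> atypical") (auto simp: add_increasing min_le_iff_disj)
  qed (intro integrable_min_exp Bochner_Integration.integrable_mult_right integrable_indicator_pmf
      Bochner_Integration.integrable_add measure_pmf.integrable_const)+
  also have "\<dots> = exp E + exp N * measure_pmf.prob p atypical"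
    by (subst Bochner_Integration.integral_add) (auto simp: integrable_indicator_pmf)
  finally have "exp N * measure_pmf.prob p {x. f x - \<mu> \<ge> 2 * u} \<le> exp E + exp N *
      (measure_pmf.prob p atypical
        + real horizon * measure_pmf.prob p {x. visits horizon x > 1 / (real n)\<^sup>2})"
    by (simp add: algebra_simps)
  also have "\<dots> \<le> exp E + exp N * err"
  proof -
    have "real horizon * measure_pmf.prob p {x. visits horizon x > 1 / (real n)\<^sup>2}
        \<le> real horizon * (real horizon * (real n)\<^sup>2 * exp (- real n))"
      by (intro mult_left_mono prob_visits_horizon) auto
    then show ?thesis
      using prob_atypical by (intro add_left_mono mult_left_mono) (auto simp: err_def algebra_simps)
  qed
  also have "\<dots> = exp N * (exp (- N + E) + err)"
    by (simp add: distrib_left exp_add[symmetric])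
  finally have "measure_pmf.prob p {x. f x - \<mu> \<ge> 2 * u} \<le> exp (- N + E) + err"
    by (simp only: mult_le_cancel_left_pos[OF exp_gt_zero])
  moreover have "- N + E = - 2 * \<theta> * u + \<theta> * (2 * KB) + KC * \<theta>\<^sup>2 * real n"
    by (simp add: N_def E_def)
  ultimately show ?thesis unfolding \<mu>_def by simp
qed

text \<open>Both theta_max and KA * theta_max are at most 1 / 2, which secures the two smallness
  conditions on theta.\<close>

definition (in supermarket) theta_max :: real where "theta_max = 1 / (2 * (KA + 1))"

lemma upper_tail_gauss:
  assumes f: "adjacent_lipschitz f" and big: "real n ^ 5 * exp (- real n) \<le> 1"
    and u: "4 * KB \<le> u" "u \<le> KC * theta_max * real n"
  shows "measure_pmf.prob p {x. f x - measure_pmf.expectation p f \<ge> 2 * u}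
    \<le> exp (- u\<^sup>2 / (2 * KC * real n)) + err"
proof -
  \<comment> \<open>Minimises - 2 * theta * u + KC * theta^2 * n. Half of the gain is given up to
    absorb the shift 2 * KB, which u >= 4 * KB permits.\<close>
  define \<theta> where "\<theta> = u / (KC * real n)"
  have n: "0 < KC * real n" using n_pos KC_pos by simp
  have u0: "0 \<le> u" using u KB_nonneg by linarith
  have t0: "0 \<le> \<theta>" using u0 n by (simp add: \<theta>_def)
  have tm: "\<theta> \<le> theta_max"
    using u n by (simp add: \<theta>_def pos_divide_le_eq mult_ac)
  also have "theta_max \<le> 1 / 2"
    using KA_pos by (simp add: theta_max_def)
  finally have t1: "2 * \<theta> \<le> 1" by simp
  have t2: "2 * KA * \<theta>\<^sup>2 \<le> 1"
  proof -
    have "2 * KA * \<theta>\<^sup>2 = (2 * \<theta>) * (KA * \<theta>)" by (simp add: power2_eq_square)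
    also have "\<dots> \<le> 1 * (KA * theta_max)"
      using t0 t1 tm KA_pos by (intro mult_mono mult_left_mono) auto
    also have "\<dots> \<le> 1" using KA_pos by (simp add: theta_max_def)
    finally show ?thesis .
  qed
  have "- 2 * \<theta> * u + \<theta> * (2 * KB) + KC * \<theta>\<^sup>2 * real n = \<theta> * (2 * KB - u)"
  proof -
    have "KC * \<theta>\<^sup>2 * real n = \<theta> * (KC * real n * \<theta>)" by (simp add: power2_eq_square)
    also have "KC * real n * \<theta> = u" 
      by (simp only: \<theta>_def times_divide_eq_right nonzero_mult_div_cancel_left[OF less_imp_neq[OF n, symmetric]])
    finally show ?thesis by (simp add: algebra_simps)
  qed
  also have "\<dots> \<le> \<theta> * (- u / 2)"
    using u t0 by (intro mult_left_mono) auto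
  also have "\<dots> = - u\<^sup>2 / (2 * KC * real n)"
    by (simp add: \<theta>_def power2_eq_square)
  finally have "exp (- 2 * \<theta> * u + \<theta> * (2 * KB) + KC * \<theta>\<^sup>2 * real n) \<le> exp (- u\<^sup>2 / (2 * KC * real n))"
    by simp
  then show ?thesis using upper_tail[OF f big t0 t1 t2, of u] by linarith
qed

lemma adjacent_lipschitz_uminus:
  "adjacent_lipschitz f \<Longrightarrow> adjacent_lipschitz (\<lambda>x. - f x)"
  by (simp add: adjacent_lipschitz_def abs_minus_commute)

lemma two_sided_tail:
  assumes f: "adjacent_lipschitz f" and big: "real n ^ 5 * exp (- real n) \<le> 1"
    and u: "4 * KB \<le> u" "u \<le> KC * theta_max * real n"
  shows "measure_pmf.prob p {x. \<bar>f x - measure_pmf.expectation p f\<bar> \<ge> 2 * u}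
    \<le> 2 * exp (- u\<^sup>2 / (2 * KC * real n)) + 2 * err"
proof -
  define \<mu> where "\<mu> = measure_pmf.expectation p f"
  have m: "measure_pmf.expectation p (\<lambda>x. - f x) = - \<mu>" by (simp add: \<mu>_def)
  have "measure_pmf.prob p {x. \<bar>f x - \<mu>\<bar> \<ge> 2 * u}
      \<le> measure_pmf.prob p ({x. f x - \<mu> \<ge> 2 * u} \<union> {x. - f x - - \<mu> \<ge> 2 * u})"
    by (intro measure_pmf.finite_measure_mono) auto
  also have "\<dots> \<le> measure_pmf.prob p {x. f x - \<mu> \<ge> 2 * u}
      + measure_pmf.prob p {x. - f x - - \<mu> \<ge> 2 * u}"
    by (rule prob_Un_le)
  finally show ?thesis
    using upper_tail_gauss[OF f big u]
      upper_tail_gauss[OF adjacent_lipschitz_uminus[OF f] big u] unfolding m by (simp add: \<mu>_def)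
qed

end

section \<open>Asymptotics in the number of queues\<close>

lemma (in supermarket) adjacent_lipschitz_of_lipschitz1:
  assumes "lipschitz1 n f"
  shows "adjacent_lipschitz f"
  unfolding adjacent_lipschitz_def
proof (intro allI impI)
  fix x :: "nat list" and j assume x: "length x = n" "j < n"
  have "\<bar>f (incr x j) - f x\<bar> \<le> l1_dist n (incr x j) x"
    using assms x by (simp add: lipschitz1_def queue_states_def)
  also have "\<dots> = (\<Sum>i<n. if i = j then 1 else 0)"
    unfolding l1_dist_def using x by (intro sum.cong) (auto simp: nth_incr)
  also have "\<dots> = 1" using x by simp
  finally show "\<bar>f (incr x j) - f x\<bar> \<le> 1" .
qed

text \<open>Exponential decay in n beats polynomials and exp ((ln n)^2) alike. The summand exp (- a
  * n) is the Gaussian bound at the end of its range.\<close>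

lemma eventually_err_le:
  fixes K a :: real
  assumes "0 \<le> K" "0 < a"
  shows "\<forall>\<^sub>F n::nat in sequentially.
    exp (- a * real n) + ((K * (real n)\<^sup>2 + 1) * (K * (real n)\<^sup>2 * (real n)\<^sup>2 * exp (- real n)) + exp (- real n))
      \<le> exp (- (ln (real n))\<^sup>2)"
proof -
  have 1: "(\<lambda>n::nat. exp ((ln (real n))\<^sup>2) * exp (- a * real n)) \<longlonglongrightarrow> 0"
    using assms by real_asymp
  have 2: "(\<lambda>n::nat. exp ((ln (real n))\<^sup>2) * (real n ^ 6 * exp (- real n))) \<longlonglongrightarrow> 0"
    by real_asymp
  have 3: "(\<lambda>n::nat. exp ((ln (real n))\<^sup>2) * (real n ^ 4 * exp (- real n))) \<longlonglongrightarrow> 0"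
    by real_asymp
  have 4: "(\<lambda>n::nat. exp ((ln (real n))\<^sup>2) * exp (- real n)) \<longlonglongrightarrow> 0"
    by real_asymp
  have "(\<lambda>n::nat. exp ((ln (real n))\<^sup>2) * exp (- a * real n)
      + (K\<^sup>2 * (exp ((ln (real n))\<^sup>2) * (real n ^ 6 * exp (- real n)))
        + K * (exp ((ln (real n))\<^sup>2) * (real n ^ 4 * exp (- real n)))
        + exp ((ln (real n))\<^sup>2) * exp (- real n))) \<longlonglongrightarrow> 0 + (K\<^sup>2 * 0 + K * 0 + 0)"
    by (intro tendsto_add tendsto_mult tendsto_const 1 2 3 4)
  then have "\<forall>\<^sub>F n::nat in sequentially. exp ((ln (real n))\<^sup>2) * exp (- a * real n)
      + (K\<^sup>2 * (exp ((ln (real n))\<^sup>2) * (real n ^ 6 * exp (- real n)))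
        + K * (exp ((ln (real n))\<^sup>2) * (real n ^ 4 * exp (- real n)))
        + exp ((ln (real n))\<^sup>2) * exp (- real n)) < 1"
    by (intro order_tendstoD(2)[where a = 1]) auto
  then show ?thesis
  proof eventually_elim
    case (elim n)
    define R where "R = exp (- a * real n)
      + ((K * (real n)\<^sup>2 + 1) * (K * (real n)\<^sup>2 * (real n)\<^sup>2 * exp (- real n)) + exp (- real n))"
    have "exp ((ln (real n))\<^sup>2) * R < 1"
      using elim by (simp add: R_def algebra_simps eval_nat_numeral)
    then have "R \<le> 1 / exp ((ln (real n))\<^sup>2)"
      by (simp add: pos_le_divide_eq mult.commute)
    then show ?case by (simp add: R_def exp_minus divide_simps)
  qed
qed

definition tail_prob :: "nat list pmf \<Rightarrow> (nat list \<Rightarrow> real) \<Rightarrow> real \<Rightarrow> real" where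
  "tail_prob p f u = measure_pmf.prob p {y. \<bar>f y - measure_pmf.expectation p f\<bar> \<ge> 2 * u}"

lemma tail_prob_le_1: "tail_prob p f u \<le> 1"
  by (simp add: tail_prob_def)

lemma tail_prob_antimono: "u \<le> v \<Longrightarrow> tail_prob p f v \<le> tail_prob p f u"
  unfolding tail_prob_def by (intro measure_pmf.finite_measure_mono) auto

lemma stationary_tail_bound:
  fixes lam :: real and d :: nat
  assumes lam: "0 < lam" "lam < 1" and d: "2 \<le> d"
  obtains c :: real where "1 \<le> c"
    "\<forall>\<^sub>F n::nat in sequentially. \<forall>p. stationary_distribution lam d n p \<longrightarrow>
      (\<forall>f. lipschitz1 n f \<longrightarrow> (\<forall>u \<ge> 1. tail_prob p f u
        \<le> 2 * exp (- u\<^sup>2 / (4 * c * (real n + u))) + 2 * exp (- (ln (real n))\<^sup>2 / c)))"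
proof -
  \<comment> \<open>\<open>KA\<close>, \<open>KB\<close> and \<open>KC\<close> depend only on lam
    and d, so the instance with one queue names them before n is chosen.\<close>
  interpret one: supermarket lam d 1
    using assms by unfold_locales auto
  define B where "B = 4 * one.KB"
  define C where "C = one.KC"
  \<comment> \<open>U * n is where the Gaussian range ends and a * n the Gaussian exponent there.
    The constant c exceeds C for that range, and B so that the claim is trivial for u < B.\<close>
  define U where "U = C * (1 / (2 * (one.KA + 1)))"
  define a where "a = U\<^sup>2 / (2 * C)"
  define c where "c = B + C + 1"
  have C: "0 < C" unfolding C_def by (rule one.KC_pos)
  have B: "0 \<le> B" unfolding B_def using one.KB_nonneg by simp
  have U: "0 < U" unfolding U_def using C one.KA_pos by simp
  have a: "0 < a" unfolding a_def using C U by simp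
  have c: "1 \<le> c" "B \<le> c" "C \<le> c" using B C by (auto simp: c_def)
  have "\<forall>\<^sub>F n::nat in sequentially. real n ^ 5 * exp (- real n) \<le> 1"
    by real_asymp
  moreover have "\<forall>\<^sub>F n::nat in sequentially. B \<le> U * real n"
    using U by real_asymp
  moreover have "\<forall>\<^sub>F n::nat in sequentially. 1 \<le> n"
    by (rule eventually_ge_at_top)
  moreover note eventually_err_le[OF of_nat_0_le_iff[of one.KL] a]
  ultimately have "\<forall>\<^sub>F n::nat in sequentially. \<forall>p. stationary_distribution lam d n p \<longrightarrow>
      (\<forall>f. lipschitz1 n f \<longrightarrow> (\<forall>u \<ge> 1. tail_prob p f u
        \<le> 2 * exp (- u\<^sup>2 / (4 * c * (real n + u))) + 2 * exp (- (ln (real n))\<^sup>2 / c)))"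
  proof eventually_elim
    case (elim n)
    show ?case
    proof (intro allI impI)
      fix p f and u :: real
      assume p: "stationary_distribution lam d n p" and f: "lipschitz1 n f" and u: "1 \<le> u"
      interpret stationary_supermarket lam d n p
        using assms elim p by unfold_locales auto
      have err: "exp (- a * real n) + err \<le> exp (- (ln (real n))\<^sup>2)"
        using elim by (simp add: err_def horizon_def)
      have n: "0 < real n" using elim by simp
      have tail: "tail_prob p f v \<le> 2 * exp (- v\<^sup>2 / (2 * C * real n)) + 2 * err"
        if "B \<le> v" "v \<le> U * real n" for v
        unfolding tail_prob_def C_def
        using two_sided_tail[OF adjacent_lipschitz_of_lipschitz1[OF f], of v] elim that
        by (simp add: B_def U_def C_def theta_max_def)
      have ln_c: "exp (- (ln (real n))\<^sup>2) \<le> exp (- (ln (real n))\<^sup>2 / c)"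
        using c mult_left_mono[of 1 c "(ln (real n))\<^sup>2"] by (simp add: pos_divide_le_eq)
      consider "u < B" | "B \<le> u" "u \<le> U * real n" | "U * real n < u" by linarith
      then show "tail_prob p f u
        \<le> 2 * exp (- u\<^sup>2 / (4 * c * (real n + u))) + 2 * exp (- (ln (real n))\<^sup>2 / c)"
      proof cases
        case 1
        \<comment> \<open>The first exponential is then at least 1 / 2, so the right side exceeds
          1.\<close>
        have "u\<^sup>2 / (4 * c * (real n + u)) \<le> 1 / 2"
        proof -
          have "u\<^sup>2 \<le> c * u" using 1 c u by (simp add: power2_eq_square)
          also have "\<dots> \<le> 2 * c * (real n + u)" using c n u by (simp add: algebra_simps)
          finally show ?thesis using c n u by (simp add: pos_divide_le_eq)
        qed
        moreover have "1 - u\<^sup>2 / (4 * c * (real n + u)) \<le> exp (- u\<^sup>2 / (4 * c * (real n + u)))"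
          using exp_ge_add_one_self[of "- u\<^sup>2 / (4 * c * (real n + u))"] by simp
        ultimately show ?thesis
          using tail_prob_le_1[of p f u] exp_gt_zero[of "- (ln (real n))\<^sup>2 / c"] by linarith
      next
        case 2
        have "2 * C * real n \<le> 4 * c * (real n + u)"
          using c C n u by (intro mult_mono) auto
        then have "u\<^sup>2 / (4 * c * (real n + u)) \<le> u\<^sup>2 / (2 * C * real n)"
          using C n c u by (intro divide_left_mono mult_pos_pos) auto
        then have "exp (- u\<^sup>2 / (2 * C * real n)) \<le> exp (- u\<^sup>2 / (4 * c * (real n + u)))"
          by simp
        then show ?thesis
          using tail[OF 2] err ln_c exp_gt_zero[of "- a * real n"] by linarith
      next
        case 3
        \<comment> \<open>Past the Gaussian range the tail at its end point is already exponentially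
          small in n, and the (ln n)^2 term absorbs it.\<close>
        have "tail_prob p f u \<le> tail_prob p f (U * real n)"
          using 3 by (intro tail_prob_antimono) auto
        also have "\<dots> \<le> 2 * exp (- (U * real n)\<^sup>2 / (2 * C * real n)) + 2 * err"
          using elim by (intro tail) auto
        also have "- (U * real n)\<^sup>2 / (2 * C * real n) = - a * real n"
          using n C by (simp add: a_def power2_eq_square)
        finally show ?thesis
          using err ln_c exp_gt_zero[of "- u\<^sup>2 / (4 * c * (real n + u))"] by linarith
      qed
    qed
  qed
  with c(1) show ?thesis by (rule that)
qed

theorem mainTheorem7:
  fixes lam :: real and d :: nat
  assumes "0 < lam" and "lam < 1" and "d \<ge> 2"
  shows
    "(\<exists>c::real. c > 0 \<and>
       (\<forall>\<^sub>F n::nat in sequentially.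
          \<forall>p. stationary_distribution lam d n p \<longrightarrow>
            (\<forall>f. lipschitz1 n f \<longrightarrow>
              (\<forall>u::real. u \<ge> 1 \<longrightarrow>
                measure_pmf.prob p {y. \<bar>f y - measure_pmf.expectation p f\<bar> \<ge> 2 * u}
                  \<le> 2 * exp (- u\<^sup>2 / (4 * c * (real n + u)))
                    + 2 * exp (- (ln (real n))\<^sup>2 / c)))))
     \<and>
     (\<forall>c0::real. c0 > 0 \<longrightarrow>
       (\<exists>c::real. c > 0 \<and>
         (\<forall>\<^sub>F n::nat in sequentially.
            \<forall>p. stationary_distribution lam d n p \<longrightarrow>
              (\<forall>f. lipschitz1 n f \<longrightarrow>
                (\<forall>u::real. 0 < u \<and> u \<le> c0 * sqrt (real n) * ln (real n) \<longrightarrow>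
                  measure_pmf.prob p {y. \<bar>f y - measure_pmf.expectation p f\<bar> \<ge> 2 * u}
                    \<le> c * exp (- u\<^sup>2 / (c * real n)))))))"
  unfolding tail_prob_def[symmetric]
proof -
  obtain c where c: "1 \<le> c" and tail: "\<forall>\<^sub>F n::nat in sequentially.
      \<forall>p. stationary_distribution lam d n p \<longrightarrow>
      (\<forall>f. lipschitz1 n f \<longrightarrow> (\<forall>u \<ge> 1. tail_prob p f u
        \<le> 2 * exp (- u\<^sup>2 / (4 * c * (real n + u))) + 2 * exp (- (ln (real n))\<^sup>2 / c)))"
    using stationary_tail_bound[OF assms] by blast
  show "(\<exists>c::real. c > 0 \<and>
       (\<forall>\<^sub>F n::nat in sequentially.
          \<forall>p. stationary_distribution lam d n p \<longrightarrow>
            (\<forall>f. lipschitz1 n f \<longrightarrow>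
              (\<forall>u::real. u \<ge> 1 \<longrightarrow>
                tail_prob p f u
                  \<le> 2 * exp (- u\<^sup>2 / (4 * c * (real n + u)))
                    + 2 * exp (- (ln (real n))\<^sup>2 / c)))))
     \<and>
     (\<forall>c0::real. c0 > 0 \<longrightarrow>
       (\<exists>c::real. c > 0 \<and>
         (\<forall>\<^sub>F n::nat in sequentially.
            \<forall>p. stationary_distribution lam d n p \<longrightarrow>
              (\<forall>f. lipschitz1 n f \<longrightarrow>
                (\<forall>u::real. 0 < u \<and> u \<le> c0 * sqrt (real n) * ln (real n) \<longrightarrow>
                  tail_prob p f u \<le> c * exp (- u\<^sup>2 / (c * real n)))))))"
  proof (intro conjI allI impI)
    show "\<exists>c::real. c > 0 \<and>
       (\<forall>\<^sub>F n::nat in sequentially.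
          \<forall>p. stationary_distribution lam d n p \<longrightarrow>
            (\<forall>f. lipschitz1 n f \<longrightarrow>
              (\<forall>u::real. u \<ge> 1 \<longrightarrow>
                tail_prob p f u
                  \<le> 2 * exp (- u\<^sup>2 / (4 * c * (real n + u)))
                    + 2 * exp (- (ln (real n))\<^sup>2 / c))))"
      using c tail by (intro exI[of _ c]) auto
  next
    fix c0 :: real assume c0: "c0 > 0"
    \<comment> \<open>The 8 * c serves n + u <= 2 * n, the c0^2 * c compares (ln n)^2 / c with u^2 /
      (C * n), and the 4 covers u < 1 and the sum of the two exponentials.\<close>
    define C where "C = 4 + 8 * c + c0\<^sup>2 * c"
    have C: "4 \<le> C" "8 * c \<le> C" "c0\<^sup>2 * c \<le> C" using c c0 by (auto simp: C_def)
    have "\<forall>\<^sub>F n::nat in sequentially. c0 * sqrt (real n) * ln (real n) \<le> real n"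
      by real_asymp
    moreover have "\<forall>\<^sub>F n::nat in sequentially. 2 \<le> n" by (rule eventually_ge_at_top)
    ultimately have "\<forall>\<^sub>F n::nat in sequentially.
            \<forall>p. stationary_distribution lam d n p \<longrightarrow>
              (\<forall>f. lipschitz1 n f \<longrightarrow>
                (\<forall>u::real. 0 < u \<and> u \<le> c0 * sqrt (real n) * ln (real n) \<longrightarrow>
                  tail_prob p f u \<le> C * exp (- u\<^sup>2 / (C * real n))))"
      using tail
    proof eventually_elim
      case (elim n)
      show ?case
      proof (intro allI impI)
        fix p f and u :: real
        assume p: "stationary_distribution lam d n p" and f: "lipschitz1 n f"
          and u: "0 < u \<and> u \<le> c0 * sqrt (real n) * ln (real n)"
        have n: "0 < real n" using elim by simp
        show "tail_prob p f u \<le> C * exp (- u\<^sup>2 / (C * real n))"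
        proof (cases "1 \<le> u")
          case False
          have "u\<^sup>2 \<le> 1" using False u by (simp add: power_le_one)
          also have "1 \<le> C * real n / 4" using C elim mult_mono[of 4 C 1 "real n"] by simp
          finally have "u\<^sup>2 / (C * real n) \<le> 1 / 4" using C n by (simp add: pos_divide_le_eq)
          then have "1 / 4 \<le> exp (- u\<^sup>2 / (C * real n))"
            using exp_ge_add_one_self[of "- u\<^sup>2 / (C * real n)"] by simp
          then have "4 * (1 / 4) \<le> C * exp (- u\<^sup>2 / (C * real n))"
            using C by (intro mult_mono) auto
          then show ?thesis using tail_prob_le_1[of p f u] by simp
        next
          case True
          have "4 * c * (real n + u) \<le> 4 * c * (2 * real n)"
            using c u elim by (intro mult_left_mono) auto
          also have "\<dots> \<le> C * real n" using C n by simp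
          finally have "u\<^sup>2 / (C * real n) \<le> u\<^sup>2 / (4 * c * (real n + u))"
            using c n True C by (intro divide_left_mono mult_pos_pos) auto
          then have e1: "exp (- u\<^sup>2 / (4 * c * (real n + u))) \<le> exp (- u\<^sup>2 / (C * real n))"
            by simp
          have "u\<^sup>2 \<le> (c0 * sqrt (real n) * ln (real n))\<^sup>2"
            using u by (intro power_mono) auto
          also have "\<dots> = (c0\<^sup>2 * c) * (real n * (ln (real n))\<^sup>2) / c"
            using n c by (simp add: power_mult_distrib)
          also have "\<dots> \<le> C * (real n * (ln (real n))\<^sup>2) / c"
            using C c by (intro divide_right_mono mult_right_mono) auto
          finally have "u\<^sup>2 / (C * real n) \<le> (ln (real n))\<^sup>2 / c"
            using C n by (simp add: pos_divide_le_eq mult_ac)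
          then have e2: "exp (- (ln (real n))\<^sup>2 / c) \<le> exp (- u\<^sup>2 / (C * real n))"
            by simp
          have "tail_prob p f u
              \<le> 2 * exp (- u\<^sup>2 / (4 * c * (real n + u))) + 2 * exp (- (ln (real n))\<^sup>2 / c)"
            using elim p f True by blast
          also have "\<dots> \<le> 4 * exp (- u\<^sup>2 / (C * real n))" using e1 e2 by linarith
          also have "\<dots> \<le> C * exp (- u\<^sup>2 / (C * real n))"
            using C by (intro mult_right_mono) auto
          finally show ?thesis .
        qed
      qed
    qed
    then show "\<exists>c::real. c > 0 \<and>
         (\<forall>\<^sub>F n::nat in sequentially.
            \<forall>p. stationary_distribution lam d n p \<longrightarrow>
              (\<forall>f. lipschitz1 n f \<longrightarrow>
                (\<forall>u::real. 0 < u \<and> u \<le> c0 * sqrt (real n) * ln (real n) \<longrightarrow>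
                  tail_prob p f u \<le> c * exp (- u\<^sup>2 / (c * real n)))))"
      using C by (intro exI[of _ C]) auto
  qed
qed

end
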